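(* Let $n\ge1$, let $I\subset\mathbb{R}$ be an interval, and let $a_{ij}$ ($i,j=1,\dots,n$), $\mathbf{b}=(b_1,\dots,b_n)$ and $c$ be real-valued measurable coefficients on $\mathbb{R}^n\times I$ satisfying the following. (1) $a_{ij}\in C^{1,0}(\mathbb{R}^n\times I)$, $a_{ij}=a_{ji}$ for $i,j=1,\dots,n$, and there is $\lambda>0$ with $\sum_{i,j=1}^n a_{ij}(x,t)\xi_i\xi_j\ge\lambda|\xi|^2$ for all $\xi\in\mathbb{R}^n$, $x\in\mathbb{R}^n$, $t\in I$; moreover $|a_{ij}(x,t)|=O(|x|^2)$ and $|\partial_i a_{ij}(x,t)|=O(|x|)$ as $|x|\to\infty$, locally uniformly in $t\in I$. (2) $\mathbf{b}\in C^{1,0}(\mathbb{R}^n\times I)$ and $\mathbf{b}(x,t)=O(|x|)$ as $|x|\to\infty$, locally uniformly in $t\in I$. (3) $c$ is nonnegative and $\operatorname{div}\mathbf{b}(x,t)\le 2c(x,t)$ for all $(x,t)\in\mathbb{R}^n\times I$. Consider the equation $$\partial_t u-\sum_{i,j=1}^n\partial_i\big(a_{ij}(x,t)\partial_j u\big)+\mathbf{b}(x,t)\cdot\nabla u+c(x,t)u=0,\quad x\in\mathbb{R}^n,\ t\in I.\qquad( * )$$ (i) Let $I=[0,T)$ with $T>0$, and let $u\in C^2(\mathbb{R}^n\times[0,T))$ be a solution of $( * )$ satisfying $u\in L^q(\mathbb{R}^n\times[0,T))$ for some $q\in[2,\infty)$ and $u(x,0)\equiv0$ on $\mathbb{R}^n$.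 Then $u\equiv0$ on $\mathbb{R}^n\times[0,T)$. (ii) Let $I=(-\infty,0)$, and let $u\in C^2(\mathbb{R}^n\times(-\infty,0))$ be a solution of $( * )$ (an ancient solution) satisfying $u\in L^q(\mathbb{R}^n\times(-\infty,0))$ for some $q\in[2,\infty)$. Then $u\equiv0$ on $\mathbb{R}^n\times(-\infty,0)$.
   Context: Functions are real-valued. $C^{1,0}(\mathbb{R}^n\times I)$ denotes functions that are $C^1$ in $x$ and continuous in $t$ (the function and its first $x$-derivatives being continuous on $\mathbb{R}^n\times I$). $\partial_i=\partial/\partial x_i$; $\nabla$ and $\operatorname{div}\mathbf{b}=\sum_{j=1}^n\partial_{x_j}b_j$ are taken with respect to $x$ only. *)

theory Defs
  imports "HOL-Analysis.Analysis" "HOL-Library.Landau_Symbols"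
begin

definition partial_deriv :: "'n::finite \<Rightarrow> (real^'n \<Rightarrow> real) \<Rightarrow> real^'n \<Rightarrow> real" where
  "partial_deriv i f x = deriv (\<lambda>s. f (x + s *\<^sub>R axis i 1)) 0"

definition gradient :: "(real^'n::finite \<Rightarrow> real) \<Rightarrow> real^'n \<Rightarrow> real^'n" where
  "gradient f x = (\<chi> i. partial_deriv i f x)"

definition divergence :: "(real^'n::finite \<Rightarrow> real^'n) \<Rightarrow> real^'n \<Rightarrow> real" where
  "divergence F x = (\<Sum>j\<in>UNIV. partial_deriv j (\<lambda>y. F y $ j) x)"

definition C10_on :: "real set \<Rightarrow> (real^'n::finite \<Rightarrow> real \<Rightarrow> real) \<Rightarrow> bool" where
  "C10_on I f \<longleftrightarrow>
     continuous_on (UNIV \<times> I) (\<lambda>(x, t). f x t) \<and>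
     (\<forall>i. (\<forall>x. \<forall>t\<in>I. (\<lambda>s. f (x + s *\<^sub>R axis i 1) t) differentiable (at 0)) \<and>
          continuous_on (UNIV \<times> I) (\<lambda>(x, t). partial_deriv i (\<lambda>y. f y t) x))"

text \<open>Derivatives are taken within the set, so that on \<open>UNIV \<times> {0..<T}\<close> they are one-sided in time
  at \<open>t = 0\<close> and are required to be continuous up to \<open>t = 0\<close>. On the sets \<open>UNIV \<times> I\<close> with \<open>I\<close> a
  nondegenerate interval they are unique.\<close>

definition C1_on :: "'a::real_normed_vector set \<Rightarrow> ('a \<Rightarrow> 'b::real_normed_vector) \<Rightarrow> bool" where
  "C1_on S f \<longleftrightarrow>
     (\<exists>f' :: 'a \<Rightarrow> ('a \<Rightarrow>\<^sub>L 'b).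
        (\<forall>p\<in>S. (f has_derivative blinfun_apply (f' p)) (at p within S)) \<and> continuous_on S f')"

definition C2_on :: "'a::real_normed_vector set \<Rightarrow> ('a \<Rightarrow> 'b::real_normed_vector) \<Rightarrow> bool" where
  "C2_on S f \<longleftrightarrow>
     (\<exists>f' :: 'a \<Rightarrow> ('a \<Rightarrow>\<^sub>L 'b).
        (\<forall>p\<in>S. (f has_derivative blinfun_apply (f' p)) (at p within S)) \<and> C1_on S f')"

text \<open>\<open>f(x,t) = O(|x|^k)\<close> as \<open>|x| \<rightarrow> \<infinity>\<close>, locally uniformly in \<open>t \<in> I\<close>: for each compact \<open>K \<subseteq> I\<close>
  the constant and the radius can be chosen independently of \<open>t \<in> K\<close>.\<close>

definition growth_loc_unif ::
  "real set \<Rightarrow> nat \<Rightarrow> (real^'n::finite \<Rightarrow> real \<Rightarrow> real) \<Rightarrow> bool" where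
  "growth_loc_unif I k f \<longleftrightarrow>
     (\<forall>K. compact K \<and> K \<subseteq> I \<longrightarrow>
        (\<lambda>(x, t). f x t) \<in> O[at_infinity \<times>\<^sub>F principal K](\<lambda>(x, t). norm x ^ k))"

definition Lq_on :: "real \<Rightarrow> 'a::euclidean_space set \<Rightarrow> ('a \<Rightarrow> real) \<Rightarrow> bool" where
  "Lq_on q S f \<longleftrightarrow>
     f \<in> borel_measurable (lebesgue_on S) \<and> integrable (lebesgue_on S) (\<lambda>p. \<bar>f p\<bar> powr q)"

definition coeff_measurable ::
  "real set \<Rightarrow> ('n::finite \<Rightarrow> 'n \<Rightarrow> real^'n \<Rightarrow> real \<Rightarrow> real) \<Rightarrow> (real^'n \<Rightarrow> real \<Rightarrow> real^'n)
     \<Rightarrow> (real^'n \<Rightarrow> real \<Rightarrow> real) \<Rightarrow> bool" where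
  "coeff_measurable I a b c \<longleftrightarrow>
     (\<forall>i j. (\<lambda>(x, t). a i j x t) \<in> borel_measurable (lebesgue_on (UNIV \<times> I))) \<and>
     (\<lambda>(x, t). b x t) \<in> borel_measurable (lebesgue_on (UNIV \<times> I)) \<and>
     (\<lambda>(x, t). c x t) \<in> borel_measurable (lebesgue_on (UNIV \<times> I))"

definition diffusion_cond ::
  "real set \<Rightarrow> ('n::finite \<Rightarrow> 'n \<Rightarrow> real^'n \<Rightarrow> real \<Rightarrow> real) \<Rightarrow> bool" where
  "diffusion_cond I a \<longleftrightarrow>
     (\<forall>i j. C10_on I (a i j)) \<and>
     (\<forall>i j x. \<forall>t\<in>I. a i j x t = a j i x t) \<and>
     (\<exists>lam>0. \<forall>\<xi> x. \<forall>t\<in>I.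
        (\<Sum>i\<in>UNIV. \<Sum>j\<in>UNIV. a i j x t * \<xi> $ i * \<xi> $ j) \<ge> lam * (norm \<xi>)\<^sup>2) \<and>
     (\<forall>i j. growth_loc_unif I 2 (a i j)) \<and>
     (\<forall>i j. growth_loc_unif I 1 (\<lambda>x t. partial_deriv i (\<lambda>y. a i j y t) x))"

definition drift_cond :: "real set \<Rightarrow> (real^'n::finite \<Rightarrow> real \<Rightarrow> real^'n) \<Rightarrow> bool" where
  "drift_cond I b \<longleftrightarrow>
     (\<forall>j. C10_on I (\<lambda>x t. b x t $ j)) \<and> growth_loc_unif I 1 (\<lambda>x t. norm (b x t))"

definition potential_cond ::
  "real set \<Rightarrow> (real^'n::finite \<Rightarrow> real \<Rightarrow> real^'n) \<Rightarrow> (real^'n \<Rightarrow> real \<Rightarrow> real) \<Rightarrow> bool" where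
  "potential_cond I b c \<longleftrightarrow>
     (\<forall>x. \<forall>t\<in>I. 0 \<le> c x t \<and> divergence (\<lambda>y. b y t) x \<le> 2 * c x t)"

text \<open>The time derivative is taken within \<open>I\<close>, hence one-sided at an endpoint belonging to \<open>I\<close>.\<close>

definition parabolic_eq ::
  "real set \<Rightarrow> ('n::finite \<Rightarrow> 'n \<Rightarrow> real^'n \<Rightarrow> real \<Rightarrow> real) \<Rightarrow> (real^'n \<Rightarrow> real \<Rightarrow> real^'n)
     \<Rightarrow> (real^'n \<Rightarrow> real \<Rightarrow> real) \<Rightarrow> (real^'n \<Rightarrow> real \<Rightarrow> real) \<Rightarrow> bool" where
  "parabolic_eq I a b c u \<longleftrightarrow>
     (\<forall>x. \<forall>t\<in>I.
        vector_derivative (\<lambda>s. u x s) (at t within I)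
        - (\<Sum>i\<in>UNIV. \<Sum>j\<in>UNIV.
             partial_deriv i (\<lambda>y. a i j y t * partial_deriv j (\<lambda>z. u z t) y) x)
        + b x t \<bullet> gradient (\<lambda>y. u y t) x
        + c x t * u x t = 0)"

end

theory Submission
  imports Defs
begin

text \<open>
  The idea is to work with \<open>w = \<bar>u\<bar>\<^sup>q\<close> instead of \<open>u\<close>. For \<open>q \<ge> 2\<close> this is a \<open>C\<^sup>2\<close> function of \<open>u\<close>, convex
  and homogeneous of degree \<open>q\<close>. Ellipticity, \<open>c \<ge> 0\<close> and \<open>div b \<le> 2 c \<le> q c\<close> then show that \<open>w\<close> satisfies
  pointwise the inequality \<open>w\<^sub>t \<le> div (a \<nabla>w - b w)\<close>
  (\<open>abs_powr_solution_is_dissipative_subsolution\<close>). So \<open>w\<close> is a nonnegative integrable subsolution of an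
  equation in conservation form, and formally its mass \<open>\<integral> w(x, t) dx\<close> cannot increase.

  To make this rigorous the inequality is multiplied by a compactly supported cutoff \<open>\<phi>\<close> of radius
  \<open>R\<close>, and all derivatives are moved to \<open>\<phi>\<close>. What remains is the error \<open>w (div (a \<nabla>\<phi>) + b \<bullet> \<nabla>\<phi>)\<close>.
  The growth conditions on \<open>a\<close>, \<open>\<partial> a\<close> and \<open>b\<close> bound the bracket uniformly
  in \<open>R\<close>, and it tends to \<open>0\<close> at each point as \<open>R \<rightarrow> \<infinity>\<close>. As \<open>w\<close> is integrable over space-time, the
  error vanishes in the limit (\<open>mass_almost_decreasing\<close>, \<open>tail_integral_tendsto_0\<close>).

  If \<open>w\<close> vanishes at time \<open>0\<close>, then its mass vanishes at all later times, and so does \<open>w\<close>, by continuity.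
  If \<open>w\<close> is ancient and has positive mass at some time, then it has at least this mass at all
  earlier times, which contradicts integrability over an unbounded time interval
  (\<open>mass_times_duration_le\<close>).
\<close>

section \<open>Partial derivatives and a divergence theorem\<close>

definition has_partial :: "'n::finite \<Rightarrow> (real^'n \<Rightarrow> real) \<Rightarrow> real \<Rightarrow> real^'n \<Rightarrow> bool" where
  "has_partial i f D x \<longleftrightarrow> ((\<lambda>s. f (x + s *\<^sub>R axis i 1)) has_real_derivative D) (at 0)"

lemma has_partial_imp_partial_deriv: "has_partial i f D x \<Longrightarrow> partial_deriv i f x = D"
  by (simp add: has_partial_def partial_deriv_def DERIV_imp_deriv)

lemma has_partial_along_line:
  assumes "\<And>x. has_partial i f (df x) x"
  shows "((\<lambda>s. f (x + s *\<^sub>R axis i 1)) has_real_derivative df (x + s *\<^sub>R axis i 1)) (at s within S)"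
proof -
  have "((\<lambda>h. f ((x + s *\<^sub>R axis i 1) + h *\<^sub>R axis i 1))
          has_real_derivative df (x + s *\<^sub>R axis i 1)) (at 0)"
    using assms unfolding has_partial_def by blast
  hence "((\<lambda>h. f (x + (h + s) *\<^sub>R axis i 1))
          has_real_derivative df (x + s *\<^sub>R axis i 1)) (at 0)"
    by (simp add: scaleR_add_left algebra_simps)
  hence "((\<lambda>s. f (x + s *\<^sub>R axis i 1)) has_real_derivative df (x + s *\<^sub>R axis i 1)) (at (0 + s))"
    by (subst DERIV_shift) simp
  thus ?thesis by (simp add: has_field_derivative_at_within)
qed

abbreviation cube :: "real \<Rightarrow> (real^'n::finite) set" where
  "cube r \<equiv> cbox (\<chi> i. - r) (\<chi> i. r)"

lemma norm_le_imp_in_cube: "norm x \<le> r \<Longrightarrow> x \<in> cube r"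
proof -
  assume a: "norm x \<le> r"
  have "\<bar>x $ i\<bar> \<le> r" for i using component_le_norm_cart[of x i] a by linarith
  thus ?thesis by (simp add: mem_box_cart abs_le_iff minus_le_iff)
qed

lemma integral_translate_within_cube:
  fixes V :: "real^'n::finite \<Rightarrow> real"
  assumes cont: "continuous_on UNIV V"
    and supp: "\<And>x. norm x > R \<Longrightarrow> V x = 0" and c: "norm c \<le> 1"
  shows "integral (cube (R + 1)) (\<lambda>x. V (x + c)) = integral (cube (R + 1)) V"
proof -
  let ?Q = "cube (R + 1) :: (real^'n) set"
  have out: "V x = 0" if "x \<notin> ?Q" for x
    using that supp norm_le_imp_in_cube[of x "R+1"] by force
  have out': "V (x + c) = 0" if "x \<notin> ?Q" for x
  proof -
    have "norm x > R + 1" using that norm_le_imp_in_cube[of x "R+1"] by force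
    moreover have "norm x \<le> norm (x + c) + norm c"
      using norm_triangle_ineq4[of "x + c" c] by simp
    ultimately show ?thesis using c supp by auto
  qed
  have V: "(V has_integral integral ?Q V) ?Q"
    using cont by (intro integrable_integral integrable_continuous) (auto intro: continuous_on_subset)
  from has_integral_affinity'[OF this, of 1 c]
  have "((\<lambda>x. V (x + c)) has_integral integral ?Q V)
      (cbox ((\<chi> i. - (R + 1)) - c) ((\<chi> i. R + 1) - c))"
    by simp
  hence "((\<lambda>x. V (x + c)) has_integral integral ?Q V) UNIV"
  proof (rule has_integral_on_superset)
    fix x assume "x \<notin> cbox ((\<chi> i. - (R + 1)) - c) ((\<chi> i. R + 1) - c)"
    hence "x + c \<notin> ?Q" by (auto simp: mem_box_cart algebra_simps)
    thus "V (x + c) = 0" by (rule out)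
  qed simp
  also have "(\<lambda>x. V (x + c)) = (\<lambda>x. if x \<in> ?Q then V (x + c) else 0)"
    using out' by auto
  finally have "((\<lambda>x. V (x + c)) has_integral integral ?Q V) ?Q"
    by (simp only: has_integral_restrict_UNIV)
  thus ?thesis by (rule integral_unique)
qed

text \<open>
  The one-dimensional fact behind the divergence theorem. The function \<open>s \<mapsto> \<integral> V (x + s e\<^sub>i) dx\<close> is
  constant because the integral is translation invariant, and its derivative at \<open>0\<close>, computed under
  the integral sign, is the integral of the partial derivative. The cube exceeds the support by one
  unit on each side, so that translations by \<open>\<bar>s\<bar> \<le> 1\<close> keep the support inside.
\<close>

lemma integral_partial_compact_support:
  fixes V :: "real^'n::finite \<Rightarrow> real"
  assumes der: "\<And>x. has_partial i V (dV x) x"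
    and cont: "continuous_on UNIV V" "continuous_on UNIV dV"
    and supp: "\<And>x. norm x > R \<Longrightarrow> V x = 0"
  shows "integral (cube (R + 1)) dV = 0"
proof -
  let ?Q = "cube (R + 1) :: (real^'n) set"
  let ?e = "axis i 1 :: real^'n"
  let ?h = "\<lambda>s. integral ?Q (\<lambda>x. V (x + s *\<^sub>R ?e))"
  have "(?h has_real_derivative integral ?Q (\<lambda>x. dV (x + 0 *\<^sub>R ?e))) (at 0 within {-1..1})"
  proof (rule leibniz_rule_field_derivative)
    show "((\<lambda>s. V (x + s *\<^sub>R ?e)) has_real_derivative dV (x + s *\<^sub>R ?e)) (at s within {-1..1})" for s x
      by (rule has_partial_along_line[OF der])
    show "(\<lambda>x. V (x + s *\<^sub>R ?e)) integrable_on ?Q" for s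
      by (intro integrable_continuous continuous_on_compose2[OF cont(1)] continuous_intros) auto
    show "continuous_on ({-1..1} \<times> ?Q) (\<lambda>(s, x). dV (x + s *\<^sub>R ?e))"
      unfolding split_beta
      by (intro continuous_on_compose2[OF cont(2)] continuous_intros) auto
  qed auto
  hence 1: "(?h has_real_derivative integral ?Q dV) (at 0)"
    by (subst (asm) at_within_interior) auto
  have "(?h has_real_derivative 0) (at 0)"
  proof (rule has_field_derivative_transform_within_open[where f = "\<lambda>_. integral ?Q V"])
    show "integral ?Q V = ?h s" if "s \<in> {-1<..<1}" for s
      using integral_translate_within_cube[OF cont(1) supp, of R "s *\<^sub>R ?e"] that
      by (auto simp: norm_axis_1)
  qed auto
  with 1 show ?thesis by (rule DERIV_unique)
qed

section \<open>A cutoff function\<close>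

text \<open>
  The exponent is at least two, which is what makes the positive part differentiable at its corner.
\<close>

lemma DERIV_positive_part_power:
  "((\<lambda>y::real. max 0 y ^ Suc (Suc n)) has_real_derivative real (Suc (Suc n)) * max 0 y ^ Suc n) (at y)"
proof -
  consider "y > 0" | "y < 0" | "y = 0" by linarith
  thus ?thesis
  proof cases
    case 1
    have "((\<lambda>y::real. y ^ Suc (Suc n)) has_real_derivative real (Suc (Suc n)) * max 0 y ^ Suc n) (at y)"
      using DERIV_pow[of "Suc (Suc n)" y UNIV] 1 by (simp add: max_def del: power_Suc)
    thus ?thesis
      by (rule has_field_derivative_transform_within_open[where S = "{0<..}"]) (use 1 in auto)
  next
    case 2
    have "((\<lambda>y::real. 0) has_real_derivative real (Suc (Suc n)) * max 0 y ^ Suc n) (at y)"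
      using 2 by (auto intro!: derivative_eq_intros simp: max_def)
    thus ?thesis
      by (rule has_field_derivative_transform_within_open[where S = "{..<0}"]) (use 2 in auto)
  next
    case 3
    have "((\<lambda>h::real. max 0 h ^ Suc (Suc n) / h) \<longlongrightarrow> 0) (at 0)"
    proof (rule Lim_null_comparison)
      have "norm (max 0 h ^ Suc (Suc n) / h) \<le> \<bar>h\<bar> ^ Suc n" for h :: real
      proof (cases "h \<le> 0")
        case True
        thus ?thesis by (simp add: max_absorb1 power_0_left del: power_Suc)
      qed (auto simp: max_def abs_mult)
      thus "\<forall>\<^sub>F h in at (0::real). norm (max 0 h ^ Suc (Suc n) / h) \<le> \<bar>h\<bar> ^ Suc n" by simp
      have "((\<lambda>h::real. \<bar>h\<bar> ^ Suc n) \<longlongrightarrow> \<bar>0\<bar> ^ Suc n) (at 0)"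
        by (intro tendsto_intros)
      thus "((\<lambda>h::real. \<bar>h\<bar> ^ Suc n) \<longlongrightarrow> 0) (at 0)" by simp
    qed
    thus ?thesis using 3 by (simp add: DERIV_def del: power_Suc)
  qed
qed

text \<open>
  The cutoff is \<open>(1 - \<bar>x\<bar>\<^sup>2 / R\<^sup>2)\<^sub>+\<^sup>3\<close>: the cube makes it \<open>C\<^sup>2\<close>. It is not constant near the origin, but
  its first and second derivatives are \<open>O(\<bar>x\<bar> / R\<^sup>2)\<close> and \<open>O(1 / R\<^sup>2)\<close>, so they tend to \<open>0\<close> at each
  point as \<open>R \<rightarrow> \<infinity>\<close>, and for coefficients of the admitted growth dominated convergence does the rest.
\<close>

definition bump :: "real \<Rightarrow> real^'n::finite \<Rightarrow> real" where
  "bump R x = max 0 (1 - (norm x)\<^sup>2 / R\<^sup>2)"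

definition cutoff :: "real \<Rightarrow> real^'n::finite \<Rightarrow> real" where
  "cutoff R x = bump R x ^ 3"

definition dcutoff :: "real \<Rightarrow> 'n \<Rightarrow> real^'n::finite \<Rightarrow> real" where
  "dcutoff R j x = - 6 * x $ j / R\<^sup>2 * bump R x ^ 2"

definition ddcutoff :: "real \<Rightarrow> 'n \<Rightarrow> 'n \<Rightarrow> real^'n::finite \<Rightarrow> real" where
  "ddcutoff R i j x =
     24 * x $ i * x $ j / R ^ 4 * bump R x - 6 * (if i = j then 1 else 0) / R\<^sup>2 * bump R x ^ 2"

lemma DERIV_norm_square_line:
  fixes x :: "real^'n::finite"
  shows "((\<lambda>s. (norm (x + s *\<^sub>R axis i 1))\<^sup>2) has_real_derivative 2 * x $ i) (at 0)"
proof -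
  have "(norm (x + s *\<^sub>R axis i 1))\<^sup>2 = (norm x)\<^sup>2 + 2 * s * x $ i + s\<^sup>2" for s
    unfolding power2_norm_eq_inner
    by (simp add: inner_axis inner_axis' inner_add algebra_simps power2_eq_square)
  thus ?thesis by (auto intro!: derivative_eq_intros)
qed

lemma DERIV_bump_power:
  fixes x :: "real^'n::finite"
  shows "((\<lambda>s. bump R (x + s *\<^sub>R axis i 1) ^ Suc (Suc n)) has_real_derivative
      - (real (Suc (Suc n)) * bump R x ^ Suc n * (2 * x $ i / R\<^sup>2))) (at 0)"
proof -
  have "((\<lambda>s. 1 - (norm (x + s *\<^sub>R axis i 1))\<^sup>2 / R\<^sup>2) has_real_derivative - (2 * x $ i / R\<^sup>2)) (at 0)"
    using DERIV_diff[OF DERIV_const[of 1] DERIV_cdivide[OF DERIV_norm_square_line[of x i], of "R\<^sup>2"]]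
    by simp
  from DERIV_chain2[OF DERIV_positive_part_power[of n] this]
  show ?thesis by (simp add: bump_def mult.assoc)
qed

lemma cutoff_has_partial: "has_partial j (cutoff R) (dcutoff R j x) x"
  using DERIV_bump_power[of R x j 1]
  by (simp add: has_partial_def cutoff_def dcutoff_def numeral_eq_Suc algebra_simps)

lemma dcutoff_has_partial: "has_partial i (dcutoff R j) (ddcutoff R i j x) x"
proof -
  have 1: "((\<lambda>s. bump R (x + s *\<^sub>R axis i 1) ^ 2) has_real_derivative
      - (2 * bump R x * (2 * x $ i / R\<^sup>2))) (at 0)"
    using DERIV_bump_power[of R x i 0] by (simp add: numeral_eq_Suc)
  have 2: "((\<lambda>s. - 6 * (x + s *\<^sub>R axis i 1) $ j / R\<^sup>2) has_real_derivative
      - 6 * (if i = j then 1 else 0) / R\<^sup>2) (at 0)"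
    by (rule DERIV_cdivide) (auto intro!: derivative_eq_intros simp: axis_def)
  show ?thesis
    unfolding has_partial_def dcutoff_def
    by (rule DERIV_cong[OF DERIV_mult[OF 2 1]])
       (simp add: ddcutoff_def power2_eq_square power4_eq_xxxx field_simps)
qed

lemma continuous_on_bump: "continuous_on S (bump R)"
  unfolding bump_def divide_inverse by (intro continuous_intros)

lemma continuous_on_cutoff:
  "continuous_on S (cutoff R)" "continuous_on S (dcutoff R j)" "continuous_on S (ddcutoff R i j)"
  unfolding cutoff_def dcutoff_def ddcutoff_def divide_inverse
  by (intro continuous_intros continuous_on_bump)+

lemma bump_bounds: "0 \<le> bump R x" "bump R x \<le> 1" and cutoff_bounds: "0 \<le> cutoff R x" "cutoff R x \<le> 1"
proof -
  show "0 \<le> bump R x" "bump R x \<le> 1" by (auto simp: bump_def)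
  thus "0 \<le> cutoff R x" "cutoff R x \<le> 1" by (auto simp: cutoff_def power_le_one)
qed

lemma bump_eq_0: "0 < R \<Longrightarrow> R < norm x \<Longrightarrow> bump R x = 0"
  by (auto simp: bump_def max_def divide_simps intro!: power_mono)

lemma cutoff_mono: "0 < R \<Longrightarrow> R \<le> R' \<Longrightarrow> cutoff R x \<le> cutoff R' x"
  unfolding cutoff_def bump_def
  by (intro power_mono max.mono diff_mono divide_left_mono) auto

lemma cutoff_pos: "norm x < R \<Longrightarrow> cutoff R x > 0"
proof -
  assume *: "norm x < R"
  hence "0 < R" using norm_ge_zero[of x] by linarith
  moreover have "(norm x)\<^sup>2 < R\<^sup>2" using * by (intro power_strict_mono) auto
  ultimately show ?thesis by (simp add: cutoff_def bump_def)
qed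

lemma dcutoff_bound:
  assumes "0 < R" shows "\<bar>dcutoff R j x\<bar> \<le> 6 * norm x / R\<^sup>2"
proof -
  have "bump R x ^ 2 \<le> 1" using bump_bounds[of R x] by (simp add: power_le_one)
  hence "\<bar>x $ j\<bar> * bump R x ^ 2 \<le> norm x * 1"
    by (intro mult_mono component_le_norm_cart) auto
  thus ?thesis using assms by (simp add: dcutoff_def abs_mult divide_simps)
qed

lemma ddcutoff_bound:
  assumes "0 < R" shows "\<bar>ddcutoff R i j x\<bar> \<le> 30 / R\<^sup>2"
proof -
  have b: "bump R x ^ 2 \<le> 1" using bump_bounds[of R x] by (simp add: power_le_one)
  have "\<bar>x $ i\<bar> * \<bar>x $ j\<bar> * bump R x \<le> R\<^sup>2"
  proof (cases "norm x > R")
    case False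
    have "\<bar>x $ i\<bar> * \<bar>x $ j\<bar> * bump R x \<le> (R * R) * 1"
      using False component_le_norm_cart[of x i] component_le_norm_cart[of x j] bump_bounds[of R x] assms
      by (intro mult_mono) auto
    thus ?thesis by (simp add: power2_eq_square)
  qed (simp add: bump_eq_0 assms)
  hence "24 * (\<bar>x $ i\<bar> * \<bar>x $ j\<bar> * bump R x) / R ^ 4 \<le> 24 * R\<^sup>2 / R ^ 4"
    by (intro divide_right_mono) auto
  also have "\<dots> = 24 / R\<^sup>2" using assms by (simp add: power2_eq_square power4_eq_xxxx)
  finally have 1: "\<bar>24 * x $ i * x $ j / R ^ 4 * bump R x\<bar> \<le> 24 / R\<^sup>2"
    using bump_bounds[of R x] by (simp add: abs_mult algebra_simps)
  have "\<bar>6 * (if i = j then 1 else 0) / R\<^sup>2 * bump R x ^ 2\<bar> \<le> 6 / R\<^sup>2 * 1"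
    unfolding abs_mult using b by (intro mult_mono) auto
  with 1 show ?thesis unfolding ddcutoff_def
    using abs_triangle_ineq4 [of "24 * x $ i * x $ j / R ^ 4 * bump R x"
        "6 * (if i = j then 1 else 0) / R\<^sup>2 * bump R x ^ 2"] by (simp add: field_simps)
qed

section \<open>Integrable subsolutions\<close>

text \<open>
  Up to a constant this weight bounds the error that the cutoff of radius \<open>R\<close> causes in the mass
  balance. It is at most one and tends to \<open>0\<close> at each point as \<open>R \<rightarrow> \<infinity>\<close>.
\<close>

definition tail_weight :: "real \<Rightarrow> real^'n::finite \<Rightarrow> real" where
  "tail_weight R x = min 1 ((1 + (norm x)\<^sup>2) / R\<^sup>2)"

lemma tail_weight_bounds: "0 \<le> tail_weight R x" "tail_weight R x \<le> 1"
  by (auto simp: tail_weight_def)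

lemma continuous_on_tail_weight: "continuous_on S (tail_weight R)"
  unfolding tail_weight_def divide_inverse by (intro continuous_intros)

lemma tail_weight_tendsto_0: "(\<lambda>k. tail_weight (real (Suc k)) x) \<longlonglongrightarrow> 0"
proof (rule Lim_null_comparison)
  show "\<forall>\<^sub>F k in sequentially. norm (tail_weight (real (Suc k)) x) \<le> (1 + (norm x)\<^sup>2) * inverse (real (Suc k))"
  proof (rule always_eventually, rule allI)
    fix k
    have "(1 + (norm x)\<^sup>2) / (real (Suc k))\<^sup>2 \<le> (1 + (norm x)\<^sup>2) / real (Suc k)"
      by (intro divide_left_mono) (auto simp: power2_eq_square)
    thus "norm (tail_weight (real (Suc k)) x) \<le> (1 + (norm x)\<^sup>2) * inverse (real (Suc k))"
      unfolding tail_weight_def by (simp add: divide_inverse min_def del: of_nat_Suc)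
  qed
  show "(\<lambda>k. (1 + (norm x)\<^sup>2) * inverse (real (Suc k))) \<longlonglongrightarrow> 0"
    using tendsto_mult_right_zero[OF LIMSEQ_inverse_real_of_nat] by blast
qed

lemma iterated_integral_cube_le:
  fixes f :: "real^'n::finite \<Rightarrow> real \<Rightarrow> real"
  assumes cont: "continuous_on (UNIV \<times> {s..t}) (\<lambda>(x, \<tau>). f x \<tau>)"
    and nonneg: "\<And>x \<tau>. \<tau> \<in> {s..t} \<Longrightarrow> 0 \<le> f x \<tau>"
    and int: "(\<lambda>(x, \<tau>). f x \<tau>) integrable_on (UNIV \<times> {s..t})"
  shows "integral {s..t} (\<lambda>\<tau>. integral (cube r) (\<lambda>x. f x \<tau>))
      \<le> integral (UNIV \<times> {s..t}) (\<lambda>(x, \<tau>). f x \<tau>)"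
proof -
  let ?B = "cbox ((\<chi> i. - r) :: real^'n, s) (\<chi> i. r, t)"
  have B: "?B \<subseteq> UNIV \<times> {s..t}" by (auto simp: cbox_Pair_eq)
  have c: "continuous_on ?B (\<lambda>(x, \<tau>). f x \<tau>)" by (rule continuous_on_subset[OF cont B])
  have "integral {s..t} (\<lambda>\<tau>. integral (cube r) (\<lambda>x. f x \<tau>))
      = integral (cube r) (\<lambda>x. integral (cbox s t) (f x))"
    using integral_swap_continuous[OF c] by simp
  also have "\<dots> = integral ?B (\<lambda>(x, \<tau>). f x \<tau>)"
    using integral_prod_continuous[OF c] by simp
  also have "\<dots> \<le> integral (UNIV \<times> {s..t}) (\<lambda>(x, \<tau>). f x \<tau>)"
    by (rule integral_subset_le[OF B integrable_continuous[OF c] int]) (use nonneg in auto)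
  finally show ?thesis .
qed

lemma abs_cutoff_le_1: "\<bar>cutoff R x\<bar> \<le> 1"
  using cutoff_bounds[of R x] by linarith

lemma abs_tail_weight_le_1: "\<bar>tail_weight R x\<bar> \<le> 1"
  using tail_weight_bounds[of R x] by linarith

lemma cube_mono: "r \<le> r' \<Longrightarrow> (cube r :: (real^'n::finite) set) \<subseteq> cube r'"
proof
  fix x :: "real^'n"
  assume r: "r \<le> r'" and x: "x \<in> cube r"
  have "- r' \<le> x $ i \<and> x $ i \<le> r'" for i
    using x r by (simp add: mem_box_cart) (metis le_minus_iff minus_le_iff order_trans)
  thus "x \<in> cube r'" by (simp add: mem_box_cart)
qed

text \<open>
  On the support of the cutoff the quotient is at most \<open>2\<close>, so truncating it at \<open>1\<close> costs a factor
  of at most \<open>2\<close>.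
\<close>

lemma tail_comparison:
  assumes "norm x \<le> R" "1 \<le> R"
  shows "(1 + (norm x)\<^sup>2) / R\<^sup>2 \<le> 2 * tail_weight R x"
proof -
  have "(norm x)\<^sup>2 \<le> R\<^sup>2" "1 \<le> R\<^sup>2" using assms by (auto intro: power_mono one_le_power)
  hence "1 + (norm x)\<^sup>2 \<le> 2 * R\<^sup>2" by linarith
  hence "(1 + (norm x)\<^sup>2) / R\<^sup>2 \<le> 2" using assms by (simp add: divide_le_eq)
  moreover have "0 \<le> (1 + (norm x)\<^sup>2) / R\<^sup>2" by simp
  ultimately show ?thesis unfolding tail_weight_def by linarith
qed

text \<open>
  A nonnegative integrable classical subsolution of the conservative equation
  \<open>w\<^sub>t = div (a \<nabla>w - b w)\<close>. The assumption \<open>subsolution\<close> is this inequality with the divergence written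
  out: \<open>da i j\<close> is \<open>\<partial>\<^sub>i a\<^sub>i\<^sub>j\<close> and \<open>db i\<close> is \<open>\<partial>\<^sub>i b\<^sub>i\<close>, the only derivatives of the coefficients
  that occur.
\<close>

locale dissipative_subsolution =
  fixes I :: "real set"
    and a da :: "'n::finite \<Rightarrow> 'n \<Rightarrow> real^'n \<Rightarrow> real \<Rightarrow> real"
    and b db :: "'n \<Rightarrow> real^'n \<Rightarrow> real \<Rightarrow> real"
    and w wt :: "real^'n \<Rightarrow> real \<Rightarrow> real"
    and Dw :: "'n \<Rightarrow> real^'n \<Rightarrow> real \<Rightarrow> real"
    and DDw :: "'n \<Rightarrow> 'n \<Rightarrow> real^'n \<Rightarrow> real \<Rightarrow> real"
  assumes a_sym: "t \<in> I \<Longrightarrow> a i j x t = a j i x t"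
    and a_partial: "t \<in> I \<Longrightarrow> has_partial i (\<lambda>y. a i j y t) (da i j x t) x"
    and b_partial: "t \<in> I \<Longrightarrow> has_partial i (\<lambda>y. b i y t) (db i x t) x"
    and w_partial: "t \<in> I \<Longrightarrow> has_partial i (\<lambda>y. w y t) (Dw i x t) x"
    and Dw_partial: "t \<in> I \<Longrightarrow> has_partial i (\<lambda>y. Dw j y t) (DDw i j x t) x"
    and w_time: "t \<in> I \<Longrightarrow> ((\<lambda>s. w x s) has_real_derivative wt x t) (at t within I)"
    and a_cont: "continuous_on (UNIV \<times> I) (\<lambda>(x, t). a i j x t)"
    and da_cont: "continuous_on (UNIV \<times> I) (\<lambda>(x, t). da i j x t)"
    and b_cont: "continuous_on (UNIV \<times> I) (\<lambda>(x, t). b i x t)"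
    and db_cont: "continuous_on (UNIV \<times> I) (\<lambda>(x, t). db i x t)"
    and w_cont: "continuous_on (UNIV \<times> I) (\<lambda>(x, t). w x t)"
    and wt_cont: "continuous_on (UNIV \<times> I) (\<lambda>(x, t). wt x t)"
    and Dw_cont: "continuous_on (UNIV \<times> I) (\<lambda>(x, t). Dw i x t)"
    and DDw_cont: "continuous_on (UNIV \<times> I) (\<lambda>(x, t). DDw i j x t)"
    and w_nonneg: "t \<in> I \<Longrightarrow> 0 \<le> w x t"
    and subsolution: "t \<in> I \<Longrightarrow> wt x t \<le>
          (\<Sum>i\<in>UNIV. \<Sum>j\<in>UNIV. da i j x t * Dw j x t + a i j x t * DDw i j x t)
          - (\<Sum>i\<in>UNIV. b i x t * Dw i x t + db i x t * w x t)"
    and growth: "{t0..t1} \<subseteq> I \<Longrightarrow> \<exists>C. \<forall>x. \<forall>t\<in>{t0..t1}. \<forall>i j.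
          \<bar>a i j x t\<bar> \<le> C * (1 + (norm x)\<^sup>2) \<and> \<bar>da i j x t\<bar> \<le> C * (1 + norm x) \<and>
          \<bar>b i x t\<bar> \<le> C * (1 + norm x)"
    and w_integrable: "(\<lambda>(x, t). w x t) integrable_on (UNIV \<times> I)"
begin

text \<open>
  The field \<open>flux\<close> is \<open>\<phi> (a \<nabla>w - b w) - w a \<nabla>\<phi>\<close> for the cutoff \<open>\<phi>\<close>. Moving the cutoff inside the
  divergence in this way leaves no derivative of \<open>w\<close> behind: by symmetry of \<open>a\<close>,
  \<open>\<phi> div (a \<nabla>w - b w) = div flux + w (div (a \<nabla>\<phi>) + b \<bullet> \<nabla>\<phi>)\<close>, where the last bracket is
  \<open>adjoint_cutoff\<close>. This is why no bound on \<open>\<nabla>w\<close> at infinity is required.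
\<close>

definition flux :: "real \<Rightarrow> 'n \<Rightarrow> real^'n \<Rightarrow> real \<Rightarrow> real" where
  "flux R i x t = (\<Sum>j\<in>UNIV. a i j x t * (cutoff R x * Dw j x t - w x t * dcutoff R j x))
     - cutoff R x * (b i x t * w x t)"

definition dflux :: "real \<Rightarrow> 'n \<Rightarrow> real^'n \<Rightarrow> real \<Rightarrow> real" where
  "dflux R i x t =
     (\<Sum>j\<in>UNIV. da i j x t * (cutoff R x * Dw j x t - w x t * dcutoff R j x)
       + a i j x t * (dcutoff R i x * Dw j x t + cutoff R x * DDw i j x t
                      - (Dw i x t * dcutoff R j x + w x t * ddcutoff R i j x)))
     - (dcutoff R i x * (b i x t * w x t) + cutoff R x * (db i x t * w x t + b i x t * Dw i x t))"

definition adjoint_cutoff :: "real \<Rightarrow> real^'n \<Rightarrow> real \<Rightarrow> real" where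
  "adjoint_cutoff R x t =
     (\<Sum>i\<in>UNIV. \<Sum>j\<in>UNIV. da i j x t * dcutoff R j x + a i j x t * ddcutoff R i j x)
     + (\<Sum>i\<in>UNIV. b i x t * dcutoff R i x)"

lemma slice_cont:
  assumes "continuous_on (UNIV \<times> I) (\<lambda>(x, t). f x t)" "t \<in> I"
  shows "continuous_on S (\<lambda>x. f x t)"
proof -
  have "continuous_on S (\<lambda>x. (\<lambda>(x, t). f x t) (x, t))"
    by (rule continuous_on_compose2[OF assms(1)]) (use assms(2) in \<open>auto intro!: continuous_intros\<close>)
  thus ?thesis by simp
qed

lemmas slice_conts = a_cont[THEN slice_cont] da_cont[THEN slice_cont] b_cont[THEN slice_cont]
  db_cont[THEN slice_cont] w_cont[THEN slice_cont] wt_cont[THEN slice_cont]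
  Dw_cont[THEN slice_cont] DDw_cont[THEN slice_cont]

lemma flux_partial:
  assumes t: "t \<in> I" shows "has_partial i (\<lambda>y. flux R i y t) (dflux R i x t) x"
proof -
  note [derivative_intros] =
    a_partial[OF t, unfolded has_partial_def] b_partial[OF t, unfolded has_partial_def]
    w_partial[OF t, unfolded has_partial_def] Dw_partial[OF t, unfolded has_partial_def]
    cutoff_has_partial[unfolded has_partial_def] dcutoff_has_partial[unfolded has_partial_def]
  show ?thesis
    unfolding has_partial_def flux_def
    by (rule DERIV_cong, (rule derivative_intros)+) (simp add: dflux_def algebra_simps)
qed

lemma integral_dflux:
  assumes t: "t \<in> I" and R: "R > 0"
  shows "integral (cube (R + 1)) (\<lambda>x. dflux R i x t) = 0"
proof (rule integral_partial_compact_support[where V = "\<lambda>x. flux R i x t"])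
  show "has_partial i (\<lambda>y. flux R i y t) (dflux R i x t) x" for x
    by (rule flux_partial[OF t])
  show "continuous_on UNIV (\<lambda>x. flux R i x t)" "continuous_on UNIV (\<lambda>x. dflux R i x t)"
    unfolding flux_def dflux_def
    by (intro continuous_intros slice_conts continuous_on_cutoff t)+
  show "flux R i x t = 0" if "R < norm x" for x
    using bump_eq_0[OF R that] by (simp add: flux_def cutoff_def dcutoff_def)
qed

text \<open>
  The two mixed terms \<open>a \<nabla>\<phi> \<bullet> \<nabla>w\<close> in \<open>div flux\<close> carry opposite signs and cancel by symmetry of \<open>a\<close>.
\<close>

lemma cutoff_times_time_derivative_le:
  assumes t: "t \<in> I"
  shows "wt x t * cutoff R x \<le> (\<Sum>i\<in>UNIV. dflux R i x t) + w x t * adjoint_cutoff R x t"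
proof -
  have "(\<Sum>i\<in>UNIV. \<Sum>j\<in>UNIV. a i j x t * dcutoff R i x * Dw j x t)
      = (\<Sum>j\<in>UNIV. \<Sum>i\<in>UNIV. a i j x t * dcutoff R i x * Dw j x t)"
    by (rule sum.swap)
  also have "\<dots> = (\<Sum>i\<in>UNIV. \<Sum>j\<in>UNIV. a i j x t * dcutoff R j x * Dw i x t)"
    by (intro sum.cong refl) (simp add: a_sym[OF t])
  finally have sym: "(\<Sum>i\<in>UNIV. \<Sum>j\<in>UNIV. a i j x t * dcutoff R i x * Dw j x t)
      = (\<Sum>i\<in>UNIV. \<Sum>j\<in>UNIV. a i j x t * dcutoff R j x * Dw i x t)" .
  have d: "dflux R i x t = cutoff R x * (\<Sum>j\<in>UNIV. da i j x t * Dw j x t + a i j x t * DDw i j x t)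
       - cutoff R x * (b i x t * Dw i x t + db i x t * w x t)
       - w x t * (\<Sum>j\<in>UNIV. da i j x t * dcutoff R j x + a i j x t * ddcutoff R i j x)
       - w x t * (b i x t * dcutoff R i x)
       + ((\<Sum>j\<in>UNIV. a i j x t * dcutoff R i x * Dw j x t)
          - (\<Sum>j\<in>UNIV. a i j x t * dcutoff R j x * Dw i x t))" for i
    unfolding dflux_def
    by (simp add: sum.distrib sum_subtractf sum_distrib_left algebra_simps)
  have "(\<Sum>i\<in>UNIV. dflux R i x t) + w x t * adjoint_cutoff R x t
     = cutoff R x * ((\<Sum>i\<in>UNIV. \<Sum>j\<in>UNIV. da i j x t * Dw j x t + a i j x t * DDw i j x t)
          - (\<Sum>i\<in>UNIV. b i x t * Dw i x t + db i x t * w x t))"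
    unfolding d adjoint_cutoff_def sum.distrib[where A = "UNIV::'n set"] sum_subtractf
      sum_distrib_left[symmetric] sym
    by (simp add: algebra_simps)
  also have "\<dots> \<ge> cutoff R x * wt x t"
    by (intro mult_left_mono subsolution t cutoff_bounds)
  finally show ?thesis by (simp add: mult.commute)
qed

definition mass :: "real \<Rightarrow> real \<Rightarrow> real" where
  "mass R t = integral (cube (R + 1)) (\<lambda>x. w x t * cutoff R x)"

lemma adjoint_cutoff_cont: "t \<in> I \<Longrightarrow> continuous_on S (\<lambda>x. adjoint_cutoff R x t)"
  unfolding adjoint_cutoff_def by (intro continuous_intros slice_conts continuous_on_cutoff)

lemma integral_time_derivative_le:
  assumes t: "t \<in> I" and R: "R > 0"
  shows "integral (cube (R + 1)) (\<lambda>x. wt x t * cutoff R x)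
       \<le> integral (cube (R + 1)) (\<lambda>x. w x t * adjoint_cutoff R x t)"
proof -
  have int: "(\<lambda>x. dflux R i x t) integrable_on cube (R + 1)" for i
    unfolding dflux_def
    by (intro integrable_continuous continuous_intros slice_conts continuous_on_cutoff t)
  have int': "(\<lambda>x. w x t * adjoint_cutoff R x t) integrable_on cube (R + 1)"
    by (intro integrable_continuous continuous_intros slice_conts adjoint_cutoff_cont t)
  have "integral (cube (R + 1)) (\<lambda>x. wt x t * cutoff R x)
     \<le> integral (cube (R + 1)) (\<lambda>x. (\<Sum>i\<in>UNIV. dflux R i x t) + w x t * adjoint_cutoff R x t)"
    by (intro integral_le cutoff_times_time_derivative_le t integrable_add integrable_sum int int'
        integrable_continuous continuous_intros slice_conts continuous_on_cutoff) auto
  also have "\<dots> = integral (cube (R + 1)) (\<lambda>x. w x t * adjoint_cutoff R x t)"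
    by (subst integral_add)
       (simp_all only: integrable_sum int int' integral_sum integral_dflux[OF t R] finite
          sum.neutral_const add_0)
  finally show ?thesis .
qed

lemma mass_time_derivative:
  assumes t: "t \<in> {t0..t1}" and sub: "{t0..t1} \<subseteq> I"
  shows "(mass R has_real_derivative integral (cube (R + 1)) (\<lambda>x. wt x t * cutoff R x))
           (at t within {t0..t1})"
  unfolding mass_def
proof (rule leibniz_rule_field_derivative[where f = "\<lambda>t x. w x t * cutoff R x"])
  show "((\<lambda>t. w x t * cutoff R x) has_real_derivative wt x t * cutoff R x) (at t within {t0..t1})"
    if "t \<in> {t0..t1}" for t x
    using DERIV_subset[OF w_time sub] that sub by (auto intro!: derivative_eq_intros)
  show "(\<lambda>x. w x t * cutoff R x) integrable_on cube (R + 1)" if "t \<in> {t0..t1}" for t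
    using that sub
    by (intro integrable_continuous continuous_intros slice_conts continuous_on_cutoff) auto
  have "continuous_on ({t0..t1} \<times> cube (R + 1)) (\<lambda>p. (\<lambda>(x, t). wt x t) (snd p, fst p))"
    by (rule continuous_on_compose2[OF wt_cont]) (use sub in \<open>auto intro!: continuous_intros\<close>)
  moreover have "continuous_on ({t0..t1} \<times> cube (R + 1)) (\<lambda>p. cutoff R (snd p))"
    by (rule continuous_on_compose2[OF continuous_on_cutoff(1)[of UNIV]]) (auto intro!: continuous_intros)
  ultimately show "continuous_on ({t0..t1} \<times> cube (R + 1)) (\<lambda>(t, x). wt x t * cutoff R x)"
    unfolding split_beta by (auto intro: continuous_on_mult)
qed (use t in auto)

text \<open>
  Here the growth conditions enter. On \<open>\<bar>x\<bar> \<le> R\<close> the quadratic growth of \<open>a\<close> meets \<open>D\<^sup>2\<phi> = O(1 / R\<^sup>2)\<close>,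
  and the linear growth of \<open>b\<close> and of the derivatives of \<open>a\<close> meets \<open>\<nabla>\<phi> = O(\<bar>x\<bar> / R\<^sup>2)\<close>; every term is
  \<open>O((1 + \<bar>x\<bar>\<^sup>2) / R\<^sup>2)\<close>. The constant collects \<open>30 + 12\<close> for each pair of indices, \<open>12\<close> for each single
  index, and the factor \<open>2\<close> of the truncation.
\<close>

lemma adjoint_cutoff_bound:
  assumes sub: "{t0..t1} \<subseteq> I"
  shows "\<exists>K\<ge>0. \<forall>R\<ge>1. \<forall>x. \<forall>t\<in>{t0..t1}. \<bar>adjoint_cutoff R x t\<bar> \<le> K * tail_weight R x"
proof -
  obtain C0 where C0: "\<And>x t i j. t \<in> {t0..t1} \<Longrightarrow>
      \<bar>a i j x t\<bar> \<le> C0 * (1 + (norm x)\<^sup>2) \<and> \<bar>da i j x t\<bar> \<le> C0 * (1 + norm x) \<and>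
      \<bar>b i x t\<bar> \<le> C0 * (1 + norm x)"
    using growth[OF sub] by blast
  define C where "C = \<bar>C0\<bar>"
  have "C0 * (1 + (norm x)\<^sup>2) \<le> C * (1 + (norm x)\<^sup>2)" "C0 * (1 + norm x) \<le> C * (1 + norm x)" for x :: "real^'n"
    unfolding C_def by (intro mult_right_mono; simp)+
  hence C: "\<bar>a i j x t\<bar> \<le> C * (1 + (norm x)\<^sup>2)" "\<bar>da i j x t\<bar> \<le> C * (1 + norm x)"
      "\<bar>b i x t\<bar> \<le> C * (1 + norm x)" if "t \<in> {t0..t1}" for i j x t
    using C0[OF that] by (meson order_trans)+
  have C_nonneg: "0 \<le> C" by (simp add: C_def)
  define N where "N = real CARD('n)"
  define K where "K = 2 * (N * (N * (42 * C)) + N * (12 * C))"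
  have "\<bar>adjoint_cutoff R x t\<bar> \<le> K * tail_weight R x" if R: "1 \<le> R" and t: "t \<in> {t0..t1}" for R x t
  proof (cases "norm x \<le> R")
    case False
    hence "bump R x = 0" using R by (intro bump_eq_0) auto
    hence "adjoint_cutoff R x t = 0" by (simp add: adjoint_cutoff_def dcutoff_def ddcutoff_def)
    thus ?thesis using tail_weight_bounds(1)[of R x] C_nonneg by (simp add: K_def N_def)
  next
    case True
    define M where "M = (1 + (norm x)\<^sup>2) / R\<^sup>2"
    have r: "(1 + norm x) * norm x \<le> 2 * (1 + (norm x)\<^sup>2)"
    proof -
      have "2 * norm x \<le> 1 + (norm x)\<^sup>2"
        using zero_le_power2[of "norm x - 1"] by (simp add: power2_eq_square algebra_simps)
      moreover have "(1 + norm x) * norm x = norm x + (norm x)\<^sup>2"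
        by (simp add: power2_eq_square algebra_simps)
      moreover have "0 \<le> norm x" "0 \<le> (norm x)\<^sup>2" by simp_all
      ultimately show ?thesis by argo
    qed
    have "C * (1 + norm x) * (6 * norm x / R\<^sup>2) = 6 * C / R\<^sup>2 * ((1 + norm x) * norm x)" by simp
    also have "\<dots> \<le> 6 * C / R\<^sup>2 * (2 * (1 + (norm x)\<^sup>2))"
      by (rule mult_left_mono[OF r]) (simp add: C_nonneg)
    also have "\<dots> = 12 * C * M" by (simp add: M_def)
    finally have first: "C * (1 + norm x) * (6 * norm x / R\<^sup>2) \<le> 12 * C * M" .
    have d: "\<bar>da i j x t * dcutoff R j x\<bar> \<le> 12 * C * M" for i j
      by (rule order_trans[OF _ first], unfold abs_mult, rule mult_mono[OF C(2)[OF t] dcutoff_bound])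
         (use R C_nonneg in auto)
    have b: "\<bar>b i x t * dcutoff R i x\<bar> \<le> 12 * C * M" for i
      by (rule order_trans[OF _ first], unfold abs_mult, rule mult_mono[OF C(3)[OF t] dcutoff_bound])
         (use R C_nonneg in auto)
    have dd: "\<bar>a i j x t * ddcutoff R i j x\<bar> \<le> C * (1 + (norm x)\<^sup>2) * (30 / R\<^sup>2)" for i j
      by (unfold abs_mult, rule mult_mono[OF C(1)[OF t] ddcutoff_bound])
         (use R C_nonneg in auto)
    have "\<bar>da i j x t * dcutoff R j x + a i j x t * ddcutoff R i j x\<bar> \<le> 42 * C * M" for i j
    proof -
      have "C * (1 + (norm x)\<^sup>2) * (30 / R\<^sup>2) = 30 * C * M" by (simp add: M_def)
      thus ?thesis using d[of i j] dd[of i j]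
          abs_triangle_ineq[of "da i j x t * dcutoff R j x" "a i j x t * ddcutoff R i j x"] by linarith
    qed
    hence "\<bar>\<Sum>i\<in>UNIV. \<Sum>j\<in>UNIV. da i j x t * dcutoff R j x + a i j x t * ddcutoff R i j x\<bar>
        \<le> N * (N * (42 * C * M))"
      unfolding N_def
      by (intro order_trans[OF sum_abs] sum_bounded_above) auto
    moreover have "\<bar>\<Sum>i\<in>UNIV. b i x t * dcutoff R i x\<bar> \<le> N * (12 * C * M)"
      unfolding N_def by (intro order_trans[OF sum_abs] sum_bounded_above b)
    ultimately have "\<bar>adjoint_cutoff R x t\<bar> \<le> N * (N * (42 * C * M)) + N * (12 * C * M)"
      unfolding adjoint_cutoff_def by linarith
    also have "\<dots> = K / 2 * M" by (simp add: K_def algebra_simps)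
    also have "\<dots> \<le> K / 2 * (2 * tail_weight R x)"
      unfolding M_def by (rule mult_left_mono[OF tail_comparison[OF True R]])
        (simp add: K_def N_def C_nonneg)
    finally show ?thesis by simp
  qed
  moreover have "K \<ge> 0" by (simp add: K_def N_def C_nonneg)
  ultimately show ?thesis by blast
qed

lemma slab_lebesgue: "(UNIV :: (real^'n) set) \<times> {t0..t1::real} \<in> sets lebesgue"
  by (intro sets_completionI_sets, unfold sets_lborel)
     (intro borel_closed closed_Times closed_UNIV closed_atLeastAtMost)

lemma w_integrable_slab:
  assumes sub: "{t0..t1} \<subseteq> I"
  shows "(\<lambda>(x, t). w x t) integrable_on (UNIV \<times> {t0..t1})"
proof -
  have "(\<lambda>(x, t). w x t) absolutely_integrable_on (UNIV \<times> I)"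
    by (rule nonnegative_absolutely_integrable_1[OF w_integrable]) (auto intro: w_nonneg)
  from set_integrable_subset[OF this slab_lebesgue] have
    "(\<lambda>(x, t). w x t) absolutely_integrable_on (UNIV \<times> {t0..t1})" using sub by blast
  thus ?thesis by (rule set_lebesgue_integral_eq_integral(1))
qed

lemma weighted_cont:
  assumes sub: "{t0..t1} \<subseteq> I" and g: "continuous_on UNIV g"
  shows "continuous_on (UNIV \<times> {t0..t1}) (\<lambda>(x, t). w x t * g x)"
proof -
  have "continuous_on (UNIV \<times> {t0..t1}) (\<lambda>p. (\<lambda>(x, t). w x t) p)"
    by (rule continuous_on_subset[OF w_cont]) (use sub in auto)
  moreover have "continuous_on (UNIV \<times> {t0..t1}) (\<lambda>p. g (fst p))"
    by (rule continuous_on_compose2[OF g]) (auto intro!: continuous_intros)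
  ultimately show ?thesis unfolding split_beta by (rule continuous_on_mult)
qed

lemma weighted_integrable:
  assumes sub: "{t0..t1} \<subseteq> I" and g: "continuous_on UNIV g" and b: "\<And>x. \<bar>g x\<bar> \<le> 1"
  shows "(\<lambda>(x, t). w x t * g x) integrable_on (UNIV \<times> {t0..t1})"
proof (rule measurable_bounded_by_integrable_imp_integrable[OF _ w_integrable_slab[OF sub] _ slab_lebesgue])
  show "(\<lambda>(x, t). w x t * g x) \<in> borel_measurable (lebesgue_on (UNIV \<times> {t0..t1}))"
    by (rule continuous_imp_measurable_on_sets_lebesgue[OF weighted_cont[OF sub g] slab_lebesgue])
  show "norm (case p of (x, t) \<Rightarrow> w x t * g x) \<le> (case p of (x, t) \<Rightarrow> w x t)"
    if "p \<in> UNIV \<times> {t0..t1}" for p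
  proof -
    obtain x t where p: "p = (x, t)" "t \<in> I" using \<open>p \<in> _\<close> sub by auto
    have "\<bar>w x t\<bar> * \<bar>g x\<bar> \<le> w x t * 1"
      using w_nonneg[OF p(2), of x] b[of x] by (intro mult_mono) auto
    thus ?thesis by (simp add: p abs_mult)
  qed
qed

lemma tail_integrable:
  assumes sub: "{t0..t1} \<subseteq> I"
  shows "(\<lambda>(x, t). w x t * tail_weight R x) integrable_on (UNIV \<times> {t0..t1})"
  by (rule weighted_integrable[OF sub continuous_on_tail_weight abs_tail_weight_le_1])

lemma tail_integral_tendsto_0:
  assumes sub: "{t0..t1} \<subseteq> I"
  shows "(\<lambda>k. integral (UNIV \<times> {t0..t1}) (\<lambda>(x, t). w x t * tail_weight (real (Suc k)) x)) \<longlonglongrightarrow> 0"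
proof -
  have "(\<lambda>k. integral (UNIV \<times> {t0..t1}) (\<lambda>(x, t). w x t * tail_weight (real (Suc k)) x))
      \<longlonglongrightarrow> integral (UNIV \<times> {t0..t1}) (\<lambda>_::(real^'n) \<times> real. 0::real)"
  proof (rule dominated_convergence(2)[OF tail_integrable[OF sub] w_integrable_slab[OF sub]])
    fix k and p :: "(real^'n) \<times> real" assume "p \<in> UNIV \<times> {t0..t1}"
    then obtain x t where p: "p = (x, t)" "t \<in> I" using sub by auto
    have "w x t * tail_weight (real (Suc k)) x \<le> w x t * 1"
      by (intro mult_left_mono tail_weight_bounds w_nonneg p)
    thus "norm (case p of (x, t) \<Rightarrow> w x t * tail_weight (real (Suc k)) x) \<le> (case p of (x, t) \<Rightarrow> w x t)"
      using w_nonneg[OF p(2), of x] tail_weight_bounds(1)[of "real (Suc k)" x] by (simp add: p abs_mult)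
  next
    fix p :: "(real^'n) \<times> real"
    show "(\<lambda>k. case p of (x, t) \<Rightarrow> w x t * tail_weight (real (Suc k)) x) \<longlonglongrightarrow> 0"
      using tendsto_mult_right_zero[OF tail_weight_tendsto_0] by (cases p) auto
  qed
  thus ?thesis by simp
qed

text \<open>
  Integrating the cutoff inequality in space and then in time bounds the growth of the mass by the
  error term. The error is an integral over the whole slab \<open>{t0..t1}\<close> and therefore independent of the
  starting time \<open>s\<close>; the result for ancient solutions depends on this uniformity.
\<close>

lemma mass_almost_decreasing:
  assumes sub: "{t0..t1} \<subseteq> I"
  shows "\<exists>K\<ge>0. \<forall>R\<ge>1. \<forall>s\<in>{t0..t1}. mass R t1 \<le> mass R s +
           K * integral (UNIV \<times> {t0..t1}) (\<lambda>(x, t). w x t * tail_weight R x)"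
proof -
  obtain K where K: "K \<ge> 0" and bound:
    "\<And>R x t. 1 \<le> R \<Longrightarrow> t \<in> {t0..t1} \<Longrightarrow> \<bar>adjoint_cutoff R x t\<bar> \<le> K * tail_weight R x"
    using adjoint_cutoff_bound[OF sub] by blast
  have "mass R t1 \<le> mass R s + K * integral (UNIV \<times> {t0..t1}) (\<lambda>(x, t). w x t * tail_weight R x)"
    if R: "R \<ge> 1" and s: "s \<in> {t0..t1}" for R s
  proof -
    let ?Q = "cube (R + 1) :: (real^'n) set"
    let ?h = "\<lambda>t. integral ?Q (\<lambda>x. w x t * tail_weight R x)"
    have sub': "{s..t1} \<subseteq> I" using s sub by auto
    have ftc: "((\<lambda>t. integral ?Q (\<lambda>x. wt x t * cutoff R x)) has_integral (mass R t1 - mass R s)) {s..t1}"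
      using mass_time_derivative[OF _ sub', of _ R] s
      by (intro fundamental_theorem_of_calculus)
         (auto simp: has_real_derivative_iff_has_vector_derivative)
    have cont_h: "continuous_on {s..t1} ?h"
    proof (rule integral_continuous_on_param)
      have "continuous_on ({s..t1} \<times> ?Q) (\<lambda>p. (\<lambda>(x, t). w x t * tail_weight R x) (snd p, fst p))"
        by (rule continuous_on_compose2[OF weighted_cont[OF sub' continuous_on_tail_weight]])
           (auto intro!: continuous_intros)
      thus "continuous_on ({s..t1} \<times> ?Q) (\<lambda>(t, x). w x t * tail_weight R x)"
        by (simp add: split_beta)
    qed
    have "integral ?Q (\<lambda>x. wt x t * cutoff R x) \<le> K * ?h t" if t: "t \<in> {s..t1}" for t
    proof -
      have tI: "t \<in> I" and t': "t \<in> {t0..t1}" using t s sub by auto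
      have "integral ?Q (\<lambda>x. wt x t * cutoff R x) \<le> integral ?Q (\<lambda>x. w x t * adjoint_cutoff R x t)"
        using R by (intro integral_time_derivative_le tI) auto
      also have "\<dots> \<le> integral ?Q (\<lambda>x. K * (w x t * tail_weight R x))"
      proof (rule integral_le)
        show "w x t * adjoint_cutoff R x t \<le> K * (w x t * tail_weight R x)" for x
        proof -
          have "w x t * adjoint_cutoff R x t \<le> w x t * (K * tail_weight R x)"
            by (intro mult_left_mono order_trans[OF abs_ge_self bound[OF R t']] w_nonneg tI)
          thus ?thesis by (simp add: mult.left_commute)
        qed
      qed (intro integrable_continuous continuous_intros slice_conts adjoint_cutoff_cont
             continuous_on_tail_weight tI)+
      finally show ?thesis by simp
    qed
    hence "integral {s..t1} (\<lambda>t. integral ?Q (\<lambda>x. wt x t * cutoff R x)) \<le> integral {s..t1} (\<lambda>t. K * ?h t)"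
      by (intro integral_le has_integral_integrable[OF ftc] integrable_continuous_interval
            continuous_intros cont_h)
    hence "mass R t1 - mass R s \<le> K * integral {s..t1} ?h"
      using ftc by (simp add: integral_unique)
    also have "\<dots> \<le> K * integral (UNIV \<times> {s..t1}) (\<lambda>(x, t). w x t * tail_weight R x)"
      using sub' w_nonneg tail_weight_bounds(1)[of R]
      by (intro mult_left_mono[OF _ K] iterated_integral_cube_le tail_integrable
            weighted_cont continuous_on_tail_weight sub') (auto intro!: mult_nonneg_nonneg)
    also have "\<dots> \<le> K * integral (UNIV \<times> {t0..t1}) (\<lambda>(x, t). w x t * tail_weight R x)"
      using sub s w_nonneg tail_weight_bounds(1)[of R]
      by (intro mult_left_mono[OF _ K] integral_subset_le tail_integrable sub sub')
         (auto intro!: mult_nonneg_nonneg)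
    finally show ?thesis by simp
  qed
  with K show ?thesis by blast
qed

lemma mass_mono:
  assumes t: "t \<in> I" and R: "0 < R" "R \<le> R'"
  shows "mass R t \<le> mass R' t"
proof -
  have int: "(\<lambda>x. w x t * cutoff R1 x) integrable_on cube R2" for R1 R2
    by (intro integrable_continuous continuous_intros slice_conts continuous_on_cutoff t)
  have "mass R t \<le> integral (cube (R + 1)) (\<lambda>x. w x t * cutoff R' x)"
    unfolding mass_def
    by (intro integral_le int mult_left_mono cutoff_mono R w_nonneg t)
  also have "\<dots> \<le> mass R' t"
    unfolding mass_def
    by (rule integral_subset_le[OF cube_mono int int])
       (use R w_nonneg[OF t] cutoff_bounds(1)[of R'] in \<open>auto intro!: mult_nonneg_nonneg\<close>)
  finally show ?thesis .
qed

lemma mass_nonneg: "t \<in> I \<Longrightarrow> 0 \<le> mass R t"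
  unfolding mass_def
  by (intro integral_nonneg integrable_continuous continuous_intros slice_conts continuous_on_cutoff)
     (auto intro!: mult_nonneg_nonneg w_nonneg cutoff_bounds)

lemma mass_eq_0_imp_eq_0:
  assumes t: "t \<in> I" and R: "norm x < R" and m: "mass R t = 0"
  shows "w x t = 0"
proof -
  let ?Q = "cube (R + 1) :: (real^'n) set"
  have R0: "0 < R" using R norm_ge_zero[of x] by linarith
  have c: "continuous_on ?Q (\<lambda>x. w x t * cutoff R x)"
    by (intro continuous_intros slice_conts continuous_on_cutoff t)
  have "w x t * cutoff R x = 0"
  proof (rule has_integral_0_cbox_imp_0[OF c])
    show "((\<lambda>x. w x t * cutoff R x) has_integral 0) ?Q"
      using integrable_integral[OF integrable_continuous[OF c]] m by (simp only: mass_def)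
    have "0 \<in> box (\<chi> i. - (R + 1)) ((\<chi> i. R + 1) :: real^'n)" using R0 by (simp add: mem_box_cart)
    thus "box (\<chi> i. - (R + 1)) ((\<chi> i. R + 1) :: real^'n) \<noteq> {}" by blast
    show "x \<in> ?Q" using R by (intro norm_le_imp_in_cube) auto
  qed (auto intro!: mult_nonneg_nonneg w_nonneg[OF t] cutoff_bounds)
  thus ?thesis using cutoff_pos[OF R] by simp
qed

text \<open>
  The mass at fixed radius is at most the mass at any larger radius, and the latter is bounded by an
  error that vanishes as the radius grows.
\<close>

theorem eq_0_of_initial_eq_0:
  assumes sub: "{t0..t1} \<subseteq> I" and le: "t0 \<le> t1" and init: "\<And>x. w x t0 = 0"
  shows "w x t1 = 0"
proof -
  have t1: "t1 \<in> I" using sub le by auto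
  obtain K where K: "\<And>R s. R \<ge> 1 \<Longrightarrow> s \<in> {t0..t1} \<Longrightarrow> mass R t1 \<le> mass R s +
       K * integral (UNIV \<times> {t0..t1}) (\<lambda>(x, t). w x t * tail_weight R x)"
    using mass_almost_decreasing[OF sub] by blast
  define R where "R = norm x + 1"
  have "mass R t1 \<le> 0"
  proof (rule LIMSEQ_le_const)
    show "(\<lambda>k. K * integral (UNIV \<times> {t0..t1}) (\<lambda>(x, t). w x t * tail_weight (real (Suc k)) x)) \<longlonglongrightarrow> 0"
      by (rule tendsto_mult_right_zero[OF tail_integral_tendsto_0[OF sub]])
    obtain k0 where k0: "R \<le> real k0" using real_arch_simple by blast
    have "mass R t1 \<le> K * integral (UNIV \<times> {t0..t1}) (\<lambda>(x, t). w x t * tail_weight (real (Suc k)) x)"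
      if "k \<ge> k0" for k
    proof -
      have "0 < R" by (simp add: R_def add_nonneg_pos)
      moreover have "R \<le> real (Suc k)" using k0 that by simp
      ultimately have "mass R t1 \<le> mass (real (Suc k)) t1" by (rule mass_mono[OF t1])
      also have "\<dots> \<le> mass (real (Suc k)) t0
          + K * integral (UNIV \<times> {t0..t1}) (\<lambda>(x, t). w x t * tail_weight (real (Suc k)) x)"
        using le by (intro K) auto
      finally show ?thesis by (simp add: mass_def init)
    qed
    thus "\<exists>N. \<forall>k\<ge>N. mass R t1 \<le> K * integral (UNIV \<times> {t0..t1}) (\<lambda>(x, t). w x t * tail_weight (real (Suc k)) x)"
      by blast
  qed
  thus ?thesis using mass_nonneg[OF t1, of R] mass_eq_0_imp_eq_0[OF t1, of x R] by (simp add: R_def)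
qed

text \<open>
  Averaging the almost-monotonicity over the starting time: since the mass hardly increases, a
  positive mass at \<open>t1\<close> forces at least as much mass at every earlier time, up to the vanishing error,
  and all of these masses together are bounded by the total integral of \<open>w\<close>.
\<close>

lemma mass_times_duration_le:
  assumes sub: "{t0..t1} \<subseteq> I" and le: "t0 \<le> t1" and R: "R > 0"
  shows "(t1 - t0) * mass R t1 \<le> integral (UNIV \<times> I) (\<lambda>(x, t). w x t)"
proof -
  let ?M = "integral (UNIV \<times> I) (\<lambda>(x, t). w x t)"
  let ?E = "\<lambda>k. integral (UNIV \<times> {t0..t1}) (\<lambda>(x, t). w x t * tail_weight (real (Suc k)) x)"
  have t1: "t1 \<in> I" using sub le by auto
  obtain K where K: "\<And>R s. R \<ge> 1 \<Longrightarrow> s \<in> {t0..t1} \<Longrightarrow> mass R t1 \<le> mass R s +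
       K * integral (UNIV \<times> {t0..t1}) (\<lambda>(x, t). w x t * tail_weight R x)"
    using mass_almost_decreasing[OF sub] by blast
  have M: "integral {t0..t1} (mass r) \<le> ?M" for r
  proof -
    have int: "(\<lambda>(x, t). w x t * cutoff r x) integrable_on (UNIV \<times> {t0..t1})"
      by (rule weighted_integrable[OF sub continuous_on_cutoff(1) abs_cutoff_le_1])
    have "integral {t0..t1} (mass r) \<le> integral (UNIV \<times> {t0..t1}) (\<lambda>(x, t). w x t * cutoff r x)"
      unfolding mass_def using sub w_nonneg cutoff_bounds(1)[of r]
      by (intro iterated_integral_cube_le int weighted_cont continuous_on_cutoff sub)
         (auto intro!: mult_nonneg_nonneg)
    also have "\<dots> \<le> integral (UNIV \<times> {t0..t1}) (\<lambda>(x, t). w x t)"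
      using sub w_nonneg cutoff_bounds[of r]
      by (intro integral_le int w_integrable_slab sub) (auto intro!: mult_left_le)
    also have "\<dots> \<le> ?M"
      using sub w_nonneg by (intro integral_subset_le w_integrable_slab w_integrable sub) auto
    finally show ?thesis .
  qed
  have "(t1 - t0) * mass R t1 \<le> ?M"
  proof (rule LIMSEQ_le_const)
    have "(\<lambda>k. ?M + (t1 - t0) * (K * ?E k)) \<longlonglongrightarrow> ?M + (t1 - t0) * (K * 0)"
      by (intro tendsto_intros tail_integral_tendsto_0 sub)
    thus "(\<lambda>k. ?M + (t1 - t0) * (K * ?E k)) \<longlonglongrightarrow> ?M" by simp
    obtain k0 where k0: "R \<le> real k0" using real_arch_simple by blast
    have "(t1 - t0) * mass R t1 \<le> ?M + (t1 - t0) * (K * ?E k)" if "k \<ge> k0" for k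
    proof -
      define r where "r = real (Suc k)"
      have r: "R \<le> r" "1 \<le> r" using k0 that by (auto simp: r_def)
      have int: "mass r integrable_on {t0..t1}"
        using mass_time_derivative[OF _ sub, of _ r]
        by (intro integrable_continuous_interval DERIV_continuous_on) auto
      have "(t1 - t0) * mass R t1 = integral {t0..t1} (\<lambda>_. mass R t1)" using le by simp
      also have "\<dots> \<le> integral {t0..t1} (\<lambda>s. mass r s + K * ?E k)"
      proof (rule integral_le)
        show "mass R t1 \<le> mass r s + K * ?E k" if "s \<in> {t0..t1}" for s
          using mass_mono[OF t1 R r(1)] K[OF r(2) that] by (simp add: r_def)
      qed (auto intro!: integrable_add int)
      also have "\<dots> = integral {t0..t1} (mass r) + (t1 - t0) * (K * ?E k)"
        using le int by (subst integral_add) auto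
      also have "\<dots> \<le> ?M + (t1 - t0) * (K * ?E k)" using M by simp
      finally show ?thesis .
    qed
    thus "\<exists>N. \<forall>k\<ge>N. (t1 - t0) * mass R t1 \<le> ?M + (t1 - t0) * (K * ?E k)" by blast
  qed
  thus ?thesis .
qed

text \<open>
  The length of the time interval in the preceding estimate is unbounded for an ancient subsolution.
\<close>

theorem eq_0_of_ancient:
  assumes sub: "{..t1} \<subseteq> I"
  shows "w x t1 = 0"
proof -
  let ?M = "integral (UNIV \<times> I) (\<lambda>(x, t). w x t)"
  define R where "R = norm x + 1"
  have R: "0 < R" by (simp add: R_def add_nonneg_pos)
  have t1: "t1 \<in> I" using sub by auto
  have "mass R t1 = 0"
  proof (rule ccontr)
    assume "mass R t1 \<noteq> 0"
    hence pos: "0 < mass R t1" using mass_nonneg[OF t1, of R] by simp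
    \<comment> \<open>a duration long enough for the mass to exceed the total integral\<close>
    define d where "d = (\<bar>?M\<bar> + 1) / mass R t1"
    have "d \<ge> 0" using pos by (simp add: d_def)
    moreover have "{t1 - d..t1} \<subseteq> I" using sub by auto
    ultimately have "d * mass R t1 \<le> ?M"
      using mass_times_duration_le[of "t1 - d" t1 R] R by simp
    thus False using pos by (simp add: d_def)
  qed
  thus ?thesis using mass_eq_0_imp_eq_0[OF t1, of x R] by (simp add: R_def)
qed

end

section \<open>Powers of solutions are subsolutions\<close>

text \<open>
  \<open>\<bar>s\<bar>\<^sup>p\<close> with \<open>0\<^sup>0 = 1\<close>. With \<open>powr\<close>, where \<open>0 powr 0 = 0\<close>, the second derivative \<open>q (q - 1) \<bar>s\<bar>\<^sup>q\<^sup>-\<^sup>2\<close> of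
  \<open>\<bar>s\<bar>\<^sup>q\<close> would have the wrong value at the origin in the case \<open>q = 2\<close>, and would be discontinuous.
\<close>

definition abs_power :: "real \<Rightarrow> real \<Rightarrow> real" where
  "abs_power p s = (if p = 0 then 1 else \<bar>s\<bar> powr p)"

lemma abs_power_nonneg: "0 \<le> abs_power p s"
  by (simp add: abs_power_def)

lemma continuous_on_abs_power: "0 \<le> p \<Longrightarrow> continuous_on S (abs_power p)"
proof (cases "p = 0")
  case False
  assume "0 \<le> p"
  with False have "0 < p" by simp
  hence "continuous_on S (\<lambda>s. \<bar>s\<bar> powr p)"
    by (intro continuous_on_powr' continuous_intros) auto
  thus ?thesis using False by (simp add: abs_power_def[abs_def])
qed (simp add: abs_power_def[abs_def])

lemma abs_powr_eq_abs_power: "\<bar>s\<bar> powr q = s\<^sup>2 * abs_power (q - 2) s"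
proof (cases "q = 2 \<or> s = 0")
  case False
  have "\<bar>s\<bar> powr q = \<bar>s\<bar> powr 2 * \<bar>s\<bar> powr (q - 2)" unfolding powr_add[symmetric] by simp
  moreover have "\<bar>s\<bar> powr 2 = s\<^sup>2" using False by (simp add: powr_numeral)
  ultimately show ?thesis using False by (simp add: abs_power_def)
qed (auto simp: abs_power_def)

lemma DERIV_times_abs_power:
  assumes "0 \<le> p"
  shows "((\<lambda>s. s * abs_power p s) has_real_derivative (p + 1) * abs_power p s) (at s)"
proof (cases "p = 0")
  case False
  hence p: "p > 0" using assms by simp
  consider "s > 0" | "s < 0" | "s = 0" by linarith
  thus ?thesis
  proof cases
    case 1
    have "((\<lambda>s. s * s powr p) has_real_derivative (p + 1) * abs_power p s) (at s)"
      by (rule DERIV_cong[OF DERIV_mult[OF DERIV_ident has_real_derivative_powr[OF 1]]])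
         (use 1 False in \<open>simp add: abs_power_def powr_diff distrib_right\<close>)
    thus ?thesis
      by (rule has_field_derivative_transform_within_open[where S = "{0<..}"])
         (use 1 False in \<open>auto simp: abs_power_def\<close>)
  next
    case 2
    have "((\<lambda>s. (- s) powr p) has_real_derivative p * (- s) powr (p - 1) * - 1) (at s)"
      using 2 by (intro DERIV_chain2[where f = "\<lambda>y. y powr p"] has_real_derivative_powr
          DERIV_minus DERIV_ident) simp
    from DERIV_mult[OF DERIV_ident this]
    have "((\<lambda>s. s * (- s) powr p) has_real_derivative (p + 1) * abs_power p s) (at s)"
      by (rule DERIV_cong) (use 2 False in \<open>simp add: abs_power_def powr_diff distrib_right\<close>)
    thus ?thesis
      by (rule has_field_derivative_transform_within_open[where S = "{..<0}"])
         (use 2 False in \<open>auto simp: abs_power_def\<close>)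
  next
    case 3
    have "isCont (abs_power p) 0"
      using continuous_on_abs_power[OF assms, of UNIV] by (simp add: continuous_on_eq_continuous_at)
    hence "(abs_power p \<longlongrightarrow> 0) (at 0)" using False by (simp add: isCont_def abs_power_def)
    hence "((\<lambda>h. h * abs_power p h / h) \<longlongrightarrow> 0) (at 0)"
      by (rule Lim_transform_within[where d = 1]) auto
    thus ?thesis using 3 False by (simp add: DERIV_def abs_power_def)
  qed
qed (auto simp: abs_power_def intro!: derivative_eq_intros)

lemma DERIV_abs_powr:
  assumes "2 \<le> q"
  shows "((\<lambda>s. \<bar>s\<bar> powr q) has_real_derivative q * (s * abs_power (q - 2) s)) (at s)"
proof -
  have "((\<lambda>s. s * (s * abs_power (q - 2) s)) has_real_derivative
      1 * (s * abs_power (q - 2) s) + (q - 2 + 1) * abs_power (q - 2) s * s) (at s)"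
    using assms by (intro DERIV_mult DERIV_times_abs_power DERIV_ident) auto
  thus ?thesis by (simp add: abs_powr_eq_abs_power power2_eq_square algebra_simps)
qed

lemma growth_loc_unif_mono:
  assumes "growth_loc_unif I k g" "\<And>x t. \<bar>f x t\<bar> \<le> \<bar>g x t\<bar>"
  shows "growth_loc_unif I k f"
  unfolding growth_loc_unif_def
proof (intro allI impI)
  fix K assume "compact K \<and> K \<subseteq> I"
  with assms(1) have g: "(\<lambda>(x, t). g x t) \<in> O[at_infinity \<times>\<^sub>F principal K](\<lambda>(x, t). norm x ^ k)"
    by (simp add: growth_loc_unif_def)
  have "(\<lambda>(x, t). f x t) \<in> O[at_infinity \<times>\<^sub>F principal K](\<lambda>(x, t). g x t)"
    by (rule landau_o.big_mono) (use assms(2) in \<open>auto intro: always_eventually\<close>)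
  from this g show "(\<lambda>(x, t). f x t) \<in> O[at_infinity \<times>\<^sub>F principal K](\<lambda>(x, t). norm x ^ k)"
    by (rule landau_o.big_trans)
qed

text \<open>
  The asymptotic bound holds outside a ball; inside the ball the function is bounded because it is
  continuous on a compact set.
\<close>

lemma growth_loc_unif_bound:
  fixes f :: "real^'n::finite \<Rightarrow> real \<Rightarrow> real"
  assumes growth: "growth_loc_unif I k f" and cont: "continuous_on (UNIV \<times> I) (\<lambda>(x, t). f x t)"
    and sub: "{t0..t1} \<subseteq> I"
  shows "\<exists>C. \<forall>p\<in>UNIV \<times> {t0..t1}. \<bar>f (fst p) (snd p)\<bar> \<le> C * (1 + norm (fst p) ^ k)"
proof -
  let ?K = "{t0..t1}"
  have "(\<lambda>(x, t). f x t) \<in> O[at_infinity \<times>\<^sub>F principal ?K](\<lambda>(x, t). norm x ^ k)"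
    using growth sub by (simp add: growth_loc_unif_def)
  then obtain c where c: "c > 0" and "\<forall>\<^sub>F p in at_infinity \<times>\<^sub>F principal ?K.
      norm (case p of (x, t) \<Rightarrow> f x t) \<le> c * norm (case p of (x, t) \<Rightarrow> norm x ^ k)"
    by (rule landau_o.bigE)
  then obtain P Q where P: "eventually P at_infinity" and Q: "eventually Q (principal ?K)"
    and PQ: "\<And>x t. P x \<Longrightarrow> Q t \<Longrightarrow> \<bar>f x t\<bar> \<le> c * norm x ^ k"
    by (auto simp: eventually_prod_filter)
  obtain r where r: "\<And>x. r \<le> norm x \<Longrightarrow> P x" using P by (auto simp: eventually_at_infinity)
  have "compact ((\<lambda>(x, t). f x t) ` (cball 0 r \<times> ?K))"
    by (intro compact_continuous_image compact_Times continuous_on_subset[OF cont])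
       (use sub in auto)
  then obtain B where B: "\<And>y. y \<in> (\<lambda>(x, t). f x t) ` (cball 0 r \<times> ?K) \<Longrightarrow> norm y \<le> B"
    using compact_imp_bounded bounded_iff by metis
  have "\<bar>f x t\<bar> \<le> (\<bar>B\<bar> + c) * (1 + norm x ^ k)" if t: "t \<in> ?K" for x t
  proof (cases "norm x \<le> r")
    case True
    hence "\<bar>f x t\<bar> \<le> B" using B[of "f x t"] t by (force simp: image_iff)
    also have "\<dots> \<le> (\<bar>B\<bar> + c) * 1" using c by simp
    also have "\<dots> \<le> (\<bar>B\<bar> + c) * (1 + norm x ^ k)" using c by (intro mult_left_mono) auto
    finally show ?thesis .
  next
    case False
    hence "\<bar>f x t\<bar> \<le> c * norm x ^ k" using PQ[of x t] r[of x] Q t by (auto simp: eventually_principal)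
    also have "\<dots> \<le> (\<bar>B\<bar> + c) * (1 + norm x ^ k)" using c by (intro mult_mono) auto
    finally show ?thesis .
  qed
  thus ?thesis by (intro exI[of _ "\<bar>B\<bar> + c"]) auto
qed

lemma uniform_bound_finite_index:
  fixes f :: "'i::finite \<Rightarrow> 'p \<Rightarrow> real"
  assumes "\<And>i. \<exists>C. \<forall>p\<in>P. f i p \<le> C * g p" and g: "\<And>p. 0 \<le> g p"
  shows "\<exists>C. \<forall>i. \<forall>p\<in>P. f i p \<le> C * g p"
proof -
  obtain C where C: "\<And>i p. p \<in> P \<Longrightarrow> f i p \<le> C i * g p" using assms(1) by metis
  have "f i p \<le> (\<Sum>i\<in>UNIV. \<bar>C i\<bar>) * g p" if "p \<in> P" for i p
  proof -
    have "C i \<le> \<bar>C i\<bar>" by simp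
    also have "\<dots> \<le> (\<Sum>i\<in>UNIV. \<bar>C i\<bar>)" by (rule member_le_sum) auto
    finally show ?thesis using C[OF that, of i] g[of p] by (meson mult_right_mono order_trans)
  qed
  thus ?thesis by blast
qed

lemma has_partial_of_has_derivative:
  fixes F :: "(real^'n::finite) \<times> real \<Rightarrow> real"
  assumes F: "(F has_derivative F') (at (x, t) within UNIV \<times> I)" and t: "t \<in> I"
  shows "has_partial i (\<lambda>y. F (y, t)) (F' (axis i 1, 0)) x"
proof -
  let ?g = "\<lambda>s::real. (x + s *\<^sub>R axis i 1, t)"
  have g: "(?g has_derivative (\<lambda>s. (s *\<^sub>R axis i 1, 0))) (at 0)"
    by (auto intro!: derivative_eq_intros)
  have "(F has_derivative F') (at (?g 0) within range ?g)"
    using has_derivative_subset[OF F, of "range ?g"] t by auto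
  from has_derivative_in_compose[OF g this]
  have "((\<lambda>s. F (?g s)) has_derivative (\<lambda>s. F' (s *\<^sub>R axis i 1, 0))) (at 0)" .
  moreover have "(\<lambda>s. F' (s *\<^sub>R axis i 1, 0)) = (*) (F' (axis i 1, 0))"
  proof (rule ext)
    show "F' (s *\<^sub>R axis i 1, 0) = F' (axis i 1, 0) * s" for s
      using linear_scale[OF has_derivative_linear[OF F], of s "(axis i 1, 0)"]
      by (simp add: mult.commute)
  qed
  ultimately show ?thesis by (simp only: has_partial_def has_field_derivative_def)
qed

lemma time_derivative_of_has_derivative:
  fixes F :: "(real^'n::finite) \<times> real \<Rightarrow> real"
  assumes F: "(F has_derivative F') (at (x, t) within UNIV \<times> I)"
  shows "((\<lambda>s. F (x, s)) has_real_derivative F' (0, 1)) (at t within I)"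
proof -
  let ?g = "\<lambda>s::real. (x, s)"
  have g: "(?g has_derivative (\<lambda>s. (0, s))) (at t within I)"
    by (auto intro!: derivative_eq_intros)
  have "(F has_derivative F') (at (?g t) within ?g ` I)"
    using has_derivative_subset[OF F, of "?g ` I"] by auto
  from has_derivative_in_compose[OF g this]
  have "((\<lambda>s. F (?g s)) has_derivative (\<lambda>s. F' (0, s))) (at t within I)" .
  moreover have "(\<lambda>s. F' (0, s)) = (*) (F' (0, 1))"
  proof (rule ext)
    show "F' (0, s) = F' (0, 1) * s" for s
      using linear_scale[OF has_derivative_linear[OF F], of s "(0, 1)"] by (simp add: mult.commute)
  qed
  ultimately show ?thesis by (simp only: has_field_derivative_def)
qed

text \<open>
  Spatial lines and time segments through a point of \<open>UNIV \<times> I\<close> stay in this set, so derivatives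
  within the set restrict to ordinary partial derivatives in space and to derivatives within \<open>I\<close> in
  time, including at an endpoint of \<open>I\<close>.
\<close>

lemma C2_on_space_time:
  fixes u :: "real^'n::finite \<Rightarrow> real \<Rightarrow> real"
  assumes "C2_on (UNIV \<times> I) (\<lambda>(x, t). u x t)"
  obtains ut :: "real^'n \<Rightarrow> real \<Rightarrow> real" and Du :: "'n \<Rightarrow> real^'n \<Rightarrow> real \<Rightarrow> real"
    and DDu :: "'n \<Rightarrow> 'n \<Rightarrow> real^'n \<Rightarrow> real \<Rightarrow> real"
  where "\<And>x t. t \<in> I \<Longrightarrow> ((\<lambda>s. u x s) has_real_derivative ut x t) (at t within I)"
    and "\<And>i x t. t \<in> I \<Longrightarrow> has_partial i (\<lambda>y. u y t) (Du i x t) x"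
    and "\<And>i j x t. t \<in> I \<Longrightarrow> has_partial i (\<lambda>y. Du j y t) (DDu i j x t) x"
    and "continuous_on (UNIV \<times> I) (\<lambda>(x, t). u x t)"
    and "continuous_on (UNIV \<times> I) (\<lambda>(x, t). ut x t)"
    and "\<And>i. continuous_on (UNIV \<times> I) (\<lambda>(x, t). Du i x t)"
    and "\<And>i j. continuous_on (UNIV \<times> I) (\<lambda>(x, t). DDu i j x t)"
proof -
  let ?S = "UNIV \<times> I :: ((real^'n) \<times> real) set"
  obtain f' :: "(real^'n) \<times> real \<Rightarrow> ((real^'n) \<times> real) \<Rightarrow>\<^sub>L real"
    where f': "\<And>p. p \<in> ?S \<Longrightarrow> ((\<lambda>(x, t). u x t) has_derivative blinfun_apply (f' p)) (at p within ?S)"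
      and C1: "C1_on ?S f'"
    using assms unfolding C2_on_def by blast
  obtain f'' :: "(real^'n) \<times> real \<Rightarrow> ((real^'n) \<times> real) \<Rightarrow>\<^sub>L (((real^'n) \<times> real) \<Rightarrow>\<^sub>L real)"
    where f'': "\<And>p. p \<in> ?S \<Longrightarrow> (f' has_derivative blinfun_apply (f'' p)) (at p within ?S)"
      and cf'': "continuous_on ?S f''"
    using C1 unfolding C1_on_def by blast
  have cf': "continuous_on ?S f'" by (rule has_derivative_continuous_on[OF f''])
  have d2: "((\<lambda>p. blinfun_apply (f' p) v) has_derivative (\<lambda>h. blinfun_apply (blinfun_apply (f'' p) h) v))
      (at p within ?S)" if "p \<in> ?S" for p v
    by (rule bounded_linear.has_derivative[OF blinfun.bounded_linear_left f''[OF that]])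
  show thesis
  proof
    fix x t i j assume t: "t \<in> I"
    hence p: "(x, t) \<in> ?S" by simp
    show "((\<lambda>s. u x s) has_real_derivative blinfun_apply (f' (x, t)) (0, 1)) (at t within I)"
      using time_derivative_of_has_derivative[OF f'[OF p]] by simp
    show "has_partial i (\<lambda>y. u y t) (blinfun_apply (f' (x, t)) (axis i 1, 0)) x"
      using has_partial_of_has_derivative[OF f'[OF p] t] by simp
    show "has_partial i (\<lambda>y. blinfun_apply (f' (y, t)) (axis j 1, 0))
        (blinfun_apply (blinfun_apply (f'' (x, t)) (axis i 1, 0)) (axis j 1, 0)) x"
      by (rule has_partial_of_has_derivative[OF d2[OF p] t])
  next
    show "continuous_on ?S (\<lambda>(x, t). u x t)" by (rule has_derivative_continuous_on[OF f'])
    show "continuous_on ?S (\<lambda>(x, t). blinfun_apply (f' (x, t)) (0, 1))"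
      and "continuous_on ?S (\<lambda>(x, t). blinfun_apply (f' (x, t)) (axis i 1, 0))"
      and "continuous_on ?S (\<lambda>(x, t). blinfun_apply (blinfun_apply (f'' (x, t)) (axis i 1, 0)) (axis j 1, 0))"
      for i j
      unfolding split_beta prod.collapse
      by (intro bounded_linear.continuous_on[OF blinfun.bounded_linear_left] cf' cf'')+
  qed
qed

lemma C10_on_has_partial:
  assumes "C10_on I f" "t \<in> I"
  shows "has_partial i (\<lambda>y. f y t) (partial_deriv i (\<lambda>y. f y t) x) x"
proof -
  have "(\<lambda>s. f (x + s *\<^sub>R axis i 1) t) differentiable (at 0)"
    using assms unfolding C10_on_def by blast
  thus ?thesis
    unfolding has_partial_def partial_deriv_def by (simp only: DERIV_deriv_iff_real_differentiable)
qed

text \<open>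
  Since \<open>F s = \<bar>s\<bar>\<^sup>q\<close> is convex with \<open>s F' s = q F s\<close>, the equation gives
  \<open>\<partial>\<^sub>t F(u) = div (a \<nabla>F(u)) - F''(u) a \<nabla>u \<bullet> \<nabla>u - b \<bullet> \<nabla>F(u) - q c F(u)\<close>. The second term is dropped by
  ellipticity, and \<open>q c \<ge> 2 c \<ge> div b\<close> turns the last two into at most \<open>- div (b F(u))\<close>.
\<close>

lemma abs_powr_solution_is_dissipative_subsolution:
  fixes a :: "'n::finite \<Rightarrow> 'n \<Rightarrow> real^'n \<Rightarrow> real \<Rightarrow> real"
    and b :: "real^'n \<Rightarrow> real \<Rightarrow> real^'n"
    and c :: "real^'n \<Rightarrow> real \<Rightarrow> real"
  assumes I: "I \<in> sets borel" "\<And>t. t \<in> I \<Longrightarrow> at t within I \<noteq> bot"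
    and a: "diffusion_cond I a" and b: "drift_cond I b" and c: "potential_cond I b c"
    and u: "C2_on (UNIV \<times> I) (\<lambda>(x, t). u x t)" and eq: "parabolic_eq I a b c u"
    and q: "2 \<le> q" and Lq: "Lq_on q (UNIV \<times> I) (\<lambda>(x, t). u x t)"
  shows "\<exists>wt Dw DDw. dissipative_subsolution I a (\<lambda>i j x t. partial_deriv i (\<lambda>y. a i j y t) x)
     (\<lambda>i x t. b x t $ i) (\<lambda>i x t. partial_deriv i (\<lambda>y. b y t $ i) x)
     (\<lambda>x t. \<bar>u x t\<bar> powr q) wt Dw DDw"
proof -
  obtain ut Du DDu where
        u_time: "\<And>x t. t \<in> I \<Longrightarrow> ((\<lambda>s. u x s) has_real_derivative ut x t) (at t within I)"
    and u_partial: "\<And>i x t. t \<in> I \<Longrightarrow> has_partial i (\<lambda>y. u y t) (Du i x t) x"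
    and Du_partial: "\<And>i j x t. t \<in> I \<Longrightarrow> has_partial i (\<lambda>y. Du j y t) (DDu i j x t) x"
    and cont: "continuous_on (UNIV \<times> I) (\<lambda>(x, t). u x t)"
      "continuous_on (UNIV \<times> I) (\<lambda>(x, t). ut x t)"
      "\<And>i. continuous_on (UNIV \<times> I) (\<lambda>(x, t). Du i x t)"
      "\<And>i j. continuous_on (UNIV \<times> I) (\<lambda>(x, t). DDu i j x t)"
    by (rule C2_on_space_time[OF u]) blast
  let ?A = "\<lambda>x t. abs_power (q - 2) (u x t)"
  let ?da = "\<lambda>i j x t. partial_deriv i (\<lambda>y. a i j y t) x"
  let ?db = "\<lambda>i x t. partial_deriv i (\<lambda>y. b y t $ i) x"
  have a10: "C10_on I (a i j)" for i j using a by (simp add: diffusion_cond_def)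
  have b10: "C10_on I (\<lambda>x t. b x t $ i)" for i using b by (simp add: drift_cond_def)
  have a_part: "has_partial i (\<lambda>y. a k j y t) (partial_deriv i (\<lambda>y. a k j y t) x) x"
    if "t \<in> I" for i k j x t by (rule C10_on_has_partial[OF a10 that])
  have "\<exists>lam>0. \<forall>\<xi> x. \<forall>t\<in>I.
      (\<Sum>i\<in>UNIV. \<Sum>j\<in>UNIV. a i j x t * \<xi> $ i * \<xi> $ j) \<ge> lam * (norm \<xi>)\<^sup>2"
    using a unfolding diffusion_cond_def by (elim conjE)
  then obtain lam where lam: "lam > 0" and "\<forall>\<xi> x. \<forall>t\<in>I.
      (\<Sum>i\<in>UNIV. \<Sum>j\<in>UNIV. a i j x t * \<xi> $ i * \<xi> $ j) \<ge> lam * (norm \<xi>)\<^sup>2"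
    by (elim exE conjE)
  hence coercive: "lam * (norm \<xi>)\<^sup>2 \<le> (\<Sum>i\<in>UNIV. \<Sum>j\<in>UNIV. a i j x t * \<xi> $ i * \<xi> $ j)"
    if "t \<in> I" for \<xi> x t using that by simp
  have elliptic: "0 \<le> (\<Sum>i\<in>UNIV. \<Sum>j\<in>UNIV. a i j x t * Du i x t * Du j x t)" if "t \<in> I" for x t
  proof -
    have "0 \<le> lam * (norm (\<chi> i. Du i x t))\<^sup>2" using lam by simp
    also have "\<dots> \<le> (\<Sum>i\<in>UNIV. \<Sum>j\<in>UNIV. a i j x t * Du i x t * Du j x t)"
      using coercive[OF that, of "\<chi> i. Du i x t" x] by simp
    finally show ?thesis .
  qed
  have ut_eq: "ut x t = (\<Sum>i\<in>UNIV. \<Sum>j\<in>UNIV. ?da i j x t * Du j x t + a i j x t * DDu i j x t)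
      - (\<Sum>i\<in>UNIV. b x t $ i * Du i x t) - c x t * u x t" if t: "t \<in> I" for x t
  proof -
    have "partial_deriv j (\<lambda>z. u z t) = (\<lambda>y. Du j y t)" for j
      using has_partial_imp_partial_deriv[OF u_partial[OF t]] by blast
    moreover have "partial_deriv i (\<lambda>y. a i j y t * Du j y t) x
        = ?da i j x t * Du j x t + a i j x t * DDu i j x t" for i j
      using DERIV_mult[OF a_part[OF t, unfolded has_partial_def] Du_partial[OF t, unfolded has_partial_def]]
      by (intro has_partial_imp_partial_deriv) (simp add: has_partial_def mult.commute)
    moreover have "vector_derivative (\<lambda>s. u x s) (at t within I) = ut x t"
      using u_time[OF t] I(2)[OF t]
      by (intro vector_derivative_within) (auto simp: has_real_derivative_iff_has_vector_derivative)
    moreover have "vector_derivative (\<lambda>s. u x s) (at t within I)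
        - (\<Sum>i\<in>UNIV. \<Sum>j\<in>UNIV. partial_deriv i (\<lambda>y. a i j y t * partial_deriv j (\<lambda>z. u z t) y) x)
        + b x t \<bullet> gradient (\<lambda>y. u y t) x + c x t * u x t = 0"
      using eq t unfolding parabolic_eq_def by blast
    ultimately show ?thesis by (simp add: gradient_def inner_vec_def)
  qed
  have contA: "continuous_on (UNIV \<times> I) (\<lambda>(x, t). ?A x t)"
    using continuous_on_compose2[OF continuous_on_abs_power[of "q - 2" UNIV] cont(1)] q
    by (simp add: split_beta)
  note conts = contA cont
  have "dissipative_subsolution I a ?da (\<lambda>i x t. b x t $ i) ?db (\<lambda>x t. \<bar>u x t\<bar> powr q)
     (\<lambda>x t. q * (u x t * ?A x t) * ut x t) (\<lambda>i x t. q * (u x t * ?A x t) * Du i x t)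
     (\<lambda>i j x t. q * ((q - 1) * ?A x t * Du i x t) * Du j x t + q * (u x t * ?A x t) * DDu i j x t)"
  proof
    fix t i j x assume t: "t \<in> I"
    show "a i j x t = a j i x t" using a t by (simp add: diffusion_cond_def)
    show "has_partial i (\<lambda>y. a i j y t) (?da i j x t) x" by (rule a_part[OF t])
    show "has_partial i (\<lambda>y. b y t $ i) (?db i x t) x" by (rule C10_on_has_partial[OF b10 t])
    note up = u_partial[OF t, unfolded has_partial_def] and Dup = Du_partial[OF t, unfolded has_partial_def]
    show "has_partial i (\<lambda>y. \<bar>u y t\<bar> powr q) (q * (u x t * ?A x t) * Du i x t) x"
      using DERIV_chain2[OF DERIV_abs_powr[OF q] up] by (simp add: has_partial_def)
    have "0 \<le> q - 2" using q by simp
    from DERIV_chain2[OF DERIV_times_abs_power[OF this] up]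
    have F': "((\<lambda>s. u (x + s *\<^sub>R axis i 1) t * ?A (x + s *\<^sub>R axis i 1) t) has_real_derivative
        (q - 1) * ?A x t * Du i x t) (at 0)" by simp
    show "has_partial i (\<lambda>y. q * (u y t * ?A y t) * Du j y t)
        (q * ((q - 1) * ?A x t * Du i x t) * Du j x t + q * (u x t * ?A x t) * DDu i j x t) x"
      unfolding has_partial_def
      by (rule DERIV_cong[OF DERIV_mult[OF DERIV_cmult[OF F'] Dup]]) (simp add: algebra_simps)
    show "((\<lambda>s. \<bar>u x s\<bar> powr q) has_real_derivative q * (u x t * ?A x t) * ut x t) (at t within I)"
      by (rule DERIV_chain2[OF DERIV_abs_powr[OF q] u_time[OF t]])
    show "0 \<le> \<bar>u x t\<bar> powr q" by simp
    let ?w = "\<bar>u x t\<bar> powr q"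
    let ?f = "q * (u x t * ?A x t)"
    have w: "?w = u x t * u x t * ?A x t" by (simp add: abs_powr_eq_abs_power power2_eq_square)
    \<comment> \<open>the divergence form, minus the ellipticity term, minus the potential term\<close>
    have "?f * ut x t =
        ((\<Sum>i\<in>UNIV. \<Sum>j\<in>UNIV. ?da i j x t * (?f * Du j x t)
            + a i j x t * (q * ((q - 1) * ?A x t * Du i x t) * Du j x t + ?f * DDu i j x t))
          - (\<Sum>i\<in>UNIV. b x t $ i * (?f * Du i x t) + ?db i x t * ?w))
        - q * (q - 1) * ?A x t * (\<Sum>i\<in>UNIV. \<Sum>j\<in>UNIV. a i j x t * Du i x t * Du j x t)
        - (q * c x t - (\<Sum>i\<in>UNIV. ?db i x t)) * ?w"
      unfolding ut_eq[OF t] w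
      by (simp add: sum.distrib sum_subtractf sum_distrib_left sum_distrib_right algebra_simps)
    moreover have "0 \<le> q * (q - 1) * ?A x t * (\<Sum>i\<in>UNIV. \<Sum>j\<in>UNIV. a i j x t * Du i x t * Du j x t)"
      using q by (intro mult_nonneg_nonneg elliptic t abs_power_nonneg) auto
    moreover have "0 \<le> (q * c x t - (\<Sum>i\<in>UNIV. ?db i x t)) * ?w"
    proof -
      have "0 \<le> c x t" "divergence (\<lambda>y. b y t) x \<le> 2 * c x t"
        using c t by (auto simp: potential_cond_def)
      moreover have "2 * c x t \<le> q * c x t" using q \<open>0 \<le> c x t\<close> by (rule mult_right_mono)
      ultimately show ?thesis unfolding divergence_def by (intro mult_nonneg_nonneg) auto
    qed
    ultimately show "?f * ut x t \<le>
        (\<Sum>i\<in>UNIV. \<Sum>j\<in>UNIV. ?da i j x t * (?f * Du j x t)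
            + a i j x t * (q * ((q - 1) * ?A x t * Du i x t) * Du j x t + ?f * DDu i j x t))
          - (\<Sum>i\<in>UNIV. b x t $ i * (?f * Du i x t) + ?db i x t * ?w)"
      by linarith
  next
    fix i j
    show "continuous_on (UNIV \<times> I) (\<lambda>(x, t). a i j x t)"
      "continuous_on (UNIV \<times> I) (\<lambda>(x, t). ?da i j x t)"
      using a10[of i j] by (auto simp: C10_on_def)
    show "continuous_on (UNIV \<times> I) (\<lambda>(x, t). b x t $ i)"
      "continuous_on (UNIV \<times> I) (\<lambda>(x, t). ?db i x t)"
      using b10[of i] by (auto simp: C10_on_def)
    show "continuous_on (UNIV \<times> I) (\<lambda>(x, t). \<bar>u x t\<bar> powr q)"
      "continuous_on (UNIV \<times> I) (\<lambda>(x, t). q * (u x t * ?A x t) * ut x t)"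
      "continuous_on (UNIV \<times> I) (\<lambda>(x, t). q * (u x t * ?A x t) * Du i x t)"
      "continuous_on (UNIV \<times> I) (\<lambda>(x, t). q * ((q - 1) * ?A x t * Du i x t) * Du j x t
         + q * (u x t * ?A x t) * DDu i j x t)"
      using conts unfolding abs_powr_eq_abs_power split_beta by (intro continuous_intros; simp)+
  next
    fix t0 t1 assume sub: "{t0..t1} \<subseteq> I"
    let ?P = "UNIV \<times> {t0..t1} :: ((real^'n) \<times> real) set"
    have "\<exists>C. \<forall>i. \<forall>p\<in>?P. \<bar>b (fst p) (snd p) $ i\<bar> \<le> C * (1 + norm (fst p) ^ 1)"
    proof (intro uniform_bound_finite_index growth_loc_unif_bound[OF _ _ sub])
      fix i
      show "growth_loc_unif I 1 (\<lambda>x t. b x t $ i)"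
        by (rule growth_loc_unif_mono[where g = "\<lambda>x t. norm (b x t)"])
           (use b in \<open>auto simp: drift_cond_def component_le_norm_cart\<close>)
      show "continuous_on (UNIV \<times> I) (\<lambda>(x, t). b x t $ i)"
        using b10[of i] by (simp add: C10_on_def)
    qed auto
    then obtain C1 where "\<forall>i. \<forall>p\<in>?P. \<bar>b (fst p) (snd p) $ i\<bar> \<le> C1 * (1 + norm (fst p) ^ 1)"
      by (rule exE)
    hence C1: "\<bar>b x t $ i\<bar> \<le> C1 * (1 + norm x)" if "t \<in> {t0..t1}" for i x t
      using that by fastforce
    have "\<exists>C. \<forall>ij. \<forall>p\<in>?P. \<bar>a (fst ij) (snd ij) (fst p) (snd p)\<bar> \<le> C * (1 + norm (fst p) ^ 2)"
      by (intro uniform_bound_finite_index growth_loc_unif_bound[OF _ _ sub])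
         (use a a10 in \<open>auto simp: diffusion_cond_def C10_on_def\<close>)
    then obtain C2 where "\<forall>ij. \<forall>p\<in>?P. \<bar>a (fst ij) (snd ij) (fst p) (snd p)\<bar> \<le> C2 * (1 + norm (fst p) ^ 2)"
      by (rule exE)
    hence C2: "\<bar>a i j x t\<bar> \<le> C2 * (1 + (norm x)\<^sup>2)" if "t \<in> {t0..t1}" for i j x t
      using that by fastforce
    have "\<exists>C. \<forall>ij. \<forall>p\<in>?P. \<bar>?da (fst ij) (snd ij) (fst p) (snd p)\<bar> \<le> C * (1 + norm (fst p) ^ 1)"
      by (intro uniform_bound_finite_index growth_loc_unif_bound[OF _ _ sub])
         (use a a10 in \<open>auto simp: diffusion_cond_def C10_on_def\<close>)
    then obtain C3 where "\<forall>ij. \<forall>p\<in>?P. \<bar>?da (fst ij) (snd ij) (fst p) (snd p)\<bar> \<le> C3 * (1 + norm (fst p) ^ 1)"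
      by (rule exE)
    hence C3: "\<bar>?da i j x t\<bar> \<le> C3 * (1 + norm x)" if "t \<in> {t0..t1}" for i j x t
      using that by fastforce
    have le: "y \<le> max C1 (max C2 C3) * g" if "y \<le> C * g" "0 \<le> g" "C \<in> {C1, C2, C3}" for y C g :: real
      using that by (elim order_trans, intro mult_right_mono) auto
    have pos: "0 \<le> 1 + norm x" "0 \<le> 1 + (norm x)\<^sup>2" for x :: "real^'n"
      by (simp_all add: add_nonneg_nonneg)
    show "\<exists>C. \<forall>x. \<forall>t\<in>{t0..t1}. \<forall>i j. \<bar>a i j x t\<bar> \<le> C * (1 + (norm x)\<^sup>2) \<and>
        \<bar>?da i j x t\<bar> \<le> C * (1 + norm x) \<and> \<bar>b x t $ i\<bar> \<le> C * (1 + norm x)"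
      using le[OF C1 pos(1)] le[OF C2 pos(2)] le[OF C3 pos(1)] by blast
  next
    have "UNIV \<times> I \<in> sets (lebesgue :: ((real^'n) \<times> real) measure)"
      by (intro sets_completionI_sets, unfold sets_lborel, rule borel_Times) (use I(1) in auto)
    moreover have "integrable (lebesgue_on (UNIV \<times> I)) (\<lambda>(x, t). \<bar>u x t\<bar> powr q)"
      using Lq by (simp add: Lq_on_def case_prod_beta')
    ultimately show "(\<lambda>(x, t). \<bar>u x t\<bar> powr q) integrable_on (UNIV \<times> I)"
      by (intro integrable_on_lebesgue_on)
  qed
  thus ?thesis by blast
qed

section \<open>Uniqueness and the Liouville property\<close>

lemma at_within_interval_neq_bot:
  fixes I :: "real set"
  assumes "connected I" "s \<in> I" "r \<in> I" "r \<noteq> s" "t \<in> I"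
  shows "at t within I \<noteq> bot"
proof -
  have "\<not> (\<exists>x. I = {x})" using assms by auto
  hence "t islimpt I" using connected_imp_perfect[of I t] assms by blast
  thus ?thesis by (simp add: trivial_limit_within)
qed

theorem corollary1p4:
  fixes a :: "'n::finite \<Rightarrow> 'n \<Rightarrow> real^'n \<Rightarrow> real \<Rightarrow> real"
    and b :: "real^'n \<Rightarrow> real \<Rightarrow> real^'n"
    and c :: "real^'n \<Rightarrow> real \<Rightarrow> real"
  shows
    "(\<forall>(T::real) (q::real) (u :: real^'n \<Rightarrow> real \<Rightarrow> real).
        T > 0 \<and>
        coeff_measurable {0..<T} a b c \<and> diffusion_cond {0..<T} a \<and>
        drift_cond {0..<T} b \<and> potential_cond {0..<T} b c \<and>
        C2_on (UNIV \<times> {0..<T}) (\<lambda>(x, t). u x t) \<and>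
        parabolic_eq {0..<T} a b c u \<and>
        2 \<le> q \<and> Lq_on q (UNIV \<times> {0..<T}) (\<lambda>(x, t). u x t) \<and>
        (\<forall>x. u x 0 = 0)
        \<longrightarrow> (\<forall>x. \<forall>t\<in>{0..<T}. u x t = 0))
     \<and>
     (\<forall>(q::real) (u :: real^'n \<Rightarrow> real \<Rightarrow> real).
        coeff_measurable {..<0} a b c \<and> diffusion_cond {..<0} a \<and>
        drift_cond {..<0} b \<and> potential_cond {..<0} b c \<and>
        C2_on (UNIV \<times> {..<0}) (\<lambda>(x, t). u x t) \<and>
        parabolic_eq {..<0} a b c u \<and>
        2 \<le> q \<and> Lq_on q (UNIV \<times> {..<0}) (\<lambda>(x, t). u x t)
        \<longrightarrow> (\<forall>x. \<forall>t\<in>{..<0}. u x t = 0))"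
proof (intro conjI allI impI ballI; elim conjE)
  fix T q t :: real and u :: "real^'n \<Rightarrow> real \<Rightarrow> real" and x :: "real^'n"
  assume T: "T > 0" and t: "t \<in> {0..<T}"
    and hyps: "diffusion_cond {0..<T} a" "drift_cond {0..<T} b" "potential_cond {0..<T} b c"
      "C2_on (UNIV \<times> {0..<T}) (\<lambda>(x, t). u x t)" "parabolic_eq {0..<T} a b c u"
      "2 \<le> q" "Lq_on q (UNIV \<times> {0..<T}) (\<lambda>(x, t). u x t)"
    and init: "\<forall>x. u x 0 = 0"
  have "at s within {0..<T} \<noteq> bot" if "s \<in> {0..<T}" for s
    by (rule at_within_interval_neq_bot[of _ 0 "T / 2"]) (use T that in auto)
  then obtain wt Dw DDw where "dissipative_subsolution {0..<T} a
      (\<lambda>i j x t. partial_deriv i (\<lambda>y. a i j y t) x)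
      (\<lambda>i x t. b x t $ i) (\<lambda>i x t. partial_deriv i (\<lambda>y. b y t $ i) x)
      (\<lambda>x t. \<bar>u x t\<bar> powr q) wt Dw DDw"
    using abs_powr_solution_is_dissipative_subsolution[OF _ _ hyps] by auto
  from dissipative_subsolution.eq_0_of_initial_eq_0[OF this, of 0 t x]
  have "\<bar>u x t\<bar> powr q = 0" using t init by (simp add: subset_iff)
  thus "u x t = 0" by simp
next
  fix q t :: real and u :: "real^'n \<Rightarrow> real \<Rightarrow> real" and x :: "real^'n"
  assume t: "t \<in> {..<0}"
    and hyps: "diffusion_cond {..<0} a" "drift_cond {..<0} b" "potential_cond {..<0} b c"
      "C2_on (UNIV \<times> {..<0}) (\<lambda>(x, t). u x t)" "parabolic_eq {..<0} a b c u"
      "2 \<le> q" "Lq_on q (UNIV \<times> {..<0}) (\<lambda>(x, t). u x t)"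
  have "at s within {..<0} \<noteq> bot" if "s \<in> {..<0}" for s :: real
    by (rule at_within_interval_neq_bot[of _ "-1" "-2"]) (use that in auto)
  then obtain wt Dw DDw where "dissipative_subsolution {..<0} a
      (\<lambda>i j x t. partial_deriv i (\<lambda>y. a i j y t) x)
      (\<lambda>i x t. b x t $ i) (\<lambda>i x t. partial_deriv i (\<lambda>y. b y t $ i) x)
      (\<lambda>x t. \<bar>u x t\<bar> powr q) wt Dw DDw"
    using abs_powr_solution_is_dissipative_subsolution[OF _ _ hyps] by auto
  from dissipative_subsolution.eq_0_of_ancient[OF this, of t x]
  have "\<bar>u x t\<bar> powr q = 0" using t by (simp add: subset_iff)
  thus "u x t = 0" by simp
qed

end
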